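(* Let $R$ be a nonzero commutative ring and let $F=(F_\bullet,\tilde d^F_\bullet)$ be a chain complex of finitely generated free $R$-modules such that for each $n\in\mathbb{Z}$ there is a submodule $G_n\subset F_n$ with $F_n=G_n\oplus\operatorname{Im}\tilde d^F_{n-1}$, and such that each $H^n(F)=\ker\tilde d^F_n/\operatorname{Im}\tilde d^F_{n-1}$ is a finitely generated free $R$-module. Then the sequence of cohomology groups $H^\bullet(F)$ with coefficients in $R$, regarded as a chain complex with all differentials zero, is a categorified eigenvalue of $F$ with eigenobject $R$.
   Context: Chain complexes are $\mathbb{Z}$-indexed with differentials $\tilde d^F_n:F_n\to F_{n+1}$, $\tilde d^F_{n+1}\circ\tilde d^F_n=0$; $\mathcal{C}({}_R\mathcal{M})$ denotes the category of chain complexes of finitely generated free $R$-modules with chain maps as morphisms. A homotopy from $f$ to $g$ (chain maps $X\to Y$) is a family $\Psi^i:X_i\to Y_{i-1}$ with $f^i-g^i=d_Y^{i-1}\circ\Psi^i+\Psi^{i+1}\circ d_X^i$ for all $i$. A chain map $f:X\to Y$ is a homotopy equivalence if there is a chain map $g:Y\to X$ with $g\circ f$ homotopic to $id_X$ and $f\circ g$ homotopic to $id_Y$. A scalar object is an object behaving symmetrically (commutatively) with respect to the tensor product. Tensor products are over $R$, $R$ is viewed as a complex concentrated in degree $0$, and $X\otimes R$ is canonically identified with $X$. An object $\lambda\in\mathcal{C}({}_R\mathcal{M})$ (a scalar object) is a categorified eigenvalue of $F$ with eigenobject $V\neq 0$ if there exists a morphism $\alpha:\lambda\to F$ such that $\alpha\otimes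 id_V:\lambda\otimes V\to F\otimes V$ is a homotopy equivalence. *)

theory Defs
  imports "HOL-Algebra.Module" "HOL-Algebra.AbelCoset"
begin

section \<open>Modules\<close>

text \<open>The record type of modules extends that of rings; the \<open>mult\<close> and \<open>one\<close> fields are
  irrelevant for modules and are left \<open>undefined\<close> below.\<close>

definition linear_maps ::
    "('r, 'e) ring_scheme \<Rightarrow> ('r, 'a, 'c) module_scheme \<Rightarrow> ('r, 'b, 'd) module_scheme \<Rightarrow> ('a \<Rightarrow> 'b) set"
  where "linear_maps R M N =
    {f \<in> carrier M \<rightarrow> carrier N.
       (\<forall>x\<in>carrier M. \<forall>y\<in>carrier M. f (x \<oplus>\<^bsub>M\<^esub> y) = f x \<oplus>\<^bsub>N\<^esub> f y) \<and>
       (\<forall>a\<in>carrier R. \<forall>x\<in>carrier M. f (a \<odot>\<^bsub>M\<^esub> x) = a \<odot>\<^bsub>N\<^esub> f x)}"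

definition fg_free :: "('r, 'e) ring_scheme \<Rightarrow> ('r, 'a, 'c) module_scheme \<Rightarrow> bool"
  where "fg_free R M \<longleftrightarrow> module R M \<and>
    (\<exists>B. finite B \<and> B \<subseteq> carrier M \<and>
       (\<forall>x\<in>carrier M. \<exists>!c. c \<in> B \<rightarrow>\<^sub>E carrier R \<and> x = (\<Oplus>\<^bsub>M\<^esub>b\<in>B. c b \<odot>\<^bsub>M\<^esub> b)))"

definition internal_direct_sum :: "('r, 'a, 'c) module_scheme \<Rightarrow> 'a set \<Rightarrow> 'a set \<Rightarrow> bool"
  where "internal_direct_sum M G H \<longleftrightarrow> G <+>\<^bsub>M\<^esub> H = carrier M \<and> G \<inter> H = {\<zero>\<^bsub>M\<^esub>}"

definition generated_submodule ::
    "('r, 'e) ring_scheme \<Rightarrow> ('r, 'a, 'c) module_scheme \<Rightarrow> 'a set \<Rightarrow> 'a set"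
  where "generated_submodule R M S = \<Inter>{N. submodule N R M \<and> S \<subseteq> N}"

definition quotient_module :: "('r, 'a, 'c) module_scheme \<Rightarrow> 'a set \<Rightarrow> ('r, 'a set) module"
  where "quotient_module M N =
    \<lparr>carrier = a_rcosets\<^bsub>M\<^esub> N, mult = undefined, one = undefined, zero = N, add = set_add M,
     smult = (\<lambda>a A. \<Union>x\<in>A. N +>\<^bsub>M\<^esub> (a \<odot>\<^bsub>M\<^esub> x))\<rparr>"

definition ring_module :: "('r, 'e) ring_scheme \<Rightarrow> ('r, 'r) module"
  where "ring_module R =
    \<lparr>carrier = carrier R, mult = mult R, one = one R, zero = zero R, add = add R, smult = mult R\<rparr>"

definition direct_sum :: "('i \<Rightarrow> ('r, 'a, 'c) module_scheme) \<Rightarrow> ('r, 'i \<Rightarrow> 'a) module"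
  where "direct_sum M =
    \<lparr>carrier = {x. (\<forall>i. x i \<in> carrier (M i)) \<and> finite {i. x i \<noteq> \<zero>\<^bsub>M i\<^esub>}},
     mult = undefined, one = undefined,
     zero = (\<lambda>i. \<zero>\<^bsub>M i\<^esub>),
     add = (\<lambda>x y i. x i \<oplus>\<^bsub>M i\<^esub> y i),
     smult = (\<lambda>a x i. a \<odot>\<^bsub>M i\<^esub> x i)\<rparr>"


section \<open>Tensor products of modules\<close>

text \<open>\<open>free_module R S\<close> consists of the finitely supported functions \<open>S \<Rightarrow> R\<close>, extended by zero
  outside of \<open>S\<close>.\<close>

definition free_module :: "('r, 'e) ring_scheme \<Rightarrow> 's set \<Rightarrow> ('r, 's \<Rightarrow> 'r) module"
  where "free_module R S =
    \<lparr>carrier = {p. (\<forall>z. p z \<in> carrier R) \<and> {z. p z \<noteq> \<zero>\<^bsub>R\<^esub>} \<subseteq> S \<and> finite {z. p z \<noteq> \<zero>\<^bsub>R\<^esub>}},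
     mult = undefined, one = undefined,
     zero = (\<lambda>z. \<zero>\<^bsub>R\<^esub>),
     add = (\<lambda>p q z. p z \<oplus>\<^bsub>R\<^esub> q z),
     smult = (\<lambda>a p z. a \<otimes>\<^bsub>R\<^esub> p z)\<rparr>"

definition free_gen :: "('r, 'e) ring_scheme \<Rightarrow> 's \<Rightarrow> 's \<Rightarrow> 'r"
  where "free_gen R z = (\<lambda>w. if w = z then \<one>\<^bsub>R\<^esub> else \<zero>\<^bsub>R\<^esub>)"

abbreviation tensor_pre ::
    "('r, 'e) ring_scheme \<Rightarrow> ('r, 'a, 'c) module_scheme \<Rightarrow> ('r, 'b, 'd) module_scheme
      \<Rightarrow> ('r, 'a \<times> 'b \<Rightarrow> 'r) module"
  where "tensor_pre R M N \<equiv> free_module R (carrier M \<times> carrier N)"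

definition tensor_relations ::
    "('r, 'e) ring_scheme \<Rightarrow> ('r, 'a, 'c) module_scheme \<Rightarrow> ('r, 'b, 'd) module_scheme
      \<Rightarrow> ('a \<times> 'b \<Rightarrow> 'r) set"
  where "tensor_relations R M N = (let P = tensor_pre R M N; e = free_gen R in
      {e (x \<oplus>\<^bsub>M\<^esub> x', y) \<ominus>\<^bsub>P\<^esub> (e (x, y) \<oplus>\<^bsub>P\<^esub> e (x', y)) | x x' y.
          x \<in> carrier M \<and> x' \<in> carrier M \<and> y \<in> carrier N}
    \<union> {e (x, y \<oplus>\<^bsub>N\<^esub> y') \<ominus>\<^bsub>P\<^esub> (e (x, y) \<oplus>\<^bsub>P\<^esub> e (x, y')) | x y y'.
          x \<in> carrier M \<and> y \<in> carrier N \<and> y' \<in> carrier N}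
    \<union> {e (a \<odot>\<^bsub>M\<^esub> x, y) \<ominus>\<^bsub>P\<^esub> a \<odot>\<^bsub>P\<^esub> e (x, y) | a x y.
          a \<in> carrier R \<and> x \<in> carrier M \<and> y \<in> carrier N}
    \<union> {e (x, a \<odot>\<^bsub>N\<^esub> y) \<ominus>\<^bsub>P\<^esub> a \<odot>\<^bsub>P\<^esub> e (x, y) | a x y.
          a \<in> carrier R \<and> x \<in> carrier M \<and> y \<in> carrier N})"

definition tensor ::
    "('r, 'e) ring_scheme \<Rightarrow> ('r, 'a, 'c) module_scheme \<Rightarrow> ('r, 'b, 'd) module_scheme
      \<Rightarrow> ('r, ('a \<times> 'b \<Rightarrow> 'r) set) module"
  where "tensor R M N =
    quotient_module (tensor_pre R M N)
      (generated_submodule R (tensor_pre R M N) (tensor_relations R M N))"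

definition pure_tensor ::
    "('r, 'e) ring_scheme \<Rightarrow> ('r, 'a, 'c) module_scheme \<Rightarrow> ('r, 'b, 'd) module_scheme
      \<Rightarrow> 'a \<Rightarrow> 'b \<Rightarrow> ('a \<times> 'b \<Rightarrow> 'r) set"
  where "pure_tensor R M N x y =
    generated_submodule R (tensor_pre R M N) (tensor_relations R M N)
      +>\<^bsub>tensor_pre R M N\<^esub> free_gen R (x, y)"

text \<open>\<open>tensor_lift R P b\<close> is the map out of the tensor product induced by a bilinear map \<open>b\<close> into
  \<open>P\<close>: a class \<open>A\<close> of formal linear combinations is sent to the common value of the linear
  extension of \<open>b\<close> on the representatives in \<open>A\<close>.\<close>

definition tensor_lift ::
    "('r, 'e) ring_scheme \<Rightarrow> ('r, 'p, 'f) module_scheme \<Rightarrow> ('a \<Rightarrow> 'b \<Rightarrow> 'p)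
      \<Rightarrow> ('a \<times> 'b \<Rightarrow> 'r) set \<Rightarrow> 'p"
  where "tensor_lift R P b A =
    the_elem ((\<lambda>p. \<Oplus>\<^bsub>P\<^esub>z\<in>{z. p z \<noteq> \<zero>\<^bsub>R\<^esub>}. p z \<odot>\<^bsub>P\<^esub> b (fst z) (snd z)) ` A)"

text \<open>\<open>tensor_map R M' N' f g\<close> is \<open>f \<otimes> g : M \<otimes> N \<rightarrow> M' \<otimes> N'\<close>.\<close>

definition tensor_map ::
    "('r, 'e) ring_scheme \<Rightarrow> ('r, 'a2, 'c) module_scheme \<Rightarrow> ('r, 'b2, 'd) module_scheme
      \<Rightarrow> ('a1 \<Rightarrow> 'a2) \<Rightarrow> ('b1 \<Rightarrow> 'b2) \<Rightarrow> ('a1 \<times> 'b1 \<Rightarrow> 'r) set \<Rightarrow> ('a2 \<times> 'b2 \<Rightarrow> 'r) set"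
  where "tensor_map R M' N' f g =
    tensor_lift R (tensor R M' N') (\<lambda>x y. pure_tensor R M' N' (f x) (g y))"


section \<open>Chain complexes\<close>

text \<open>Differentials raise the degree by one. Maps between modules are only meaningful on the
  carriers, so equality of maps is always stated there. All modules of a complex live in one
  element type, but their carriers are unrelated.\<close>

record ('r, 'm) chain_cplx =
  Obj :: "int \<Rightarrow> ('r, 'm) module"
  Dif :: "int \<Rightarrow> 'm \<Rightarrow> 'm"

definition chain_complex :: "('r, 'e) ring_scheme \<Rightarrow> ('r, 'm) chain_cplx \<Rightarrow> bool"
  where "chain_complex R X \<longleftrightarrow>
    (\<forall>n. module R (Obj X n)) \<and>
    (\<forall>n. Dif X n \<in> linear_maps R (Obj X n) (Obj X (n + 1))) \<and>
    (\<forall>n. \<forall>x\<in>carrier (Obj X n). Dif X (n + 1) (Dif X n x) = \<zero>\<^bsub>Obj X (n + 2)\<^esub>)"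

text \<open>These are the objects of the category in which eigenvalues and eigenobjects live.\<close>

definition fg_free_complex :: "('r, 'e) ring_scheme \<Rightarrow> ('r, 'm) chain_cplx \<Rightarrow> bool"
  where "fg_free_complex R X \<longleftrightarrow> chain_complex R X \<and> (\<forall>n. fg_free R (Obj X n))"

definition chain_map ::
    "('r, 'e) ring_scheme \<Rightarrow> ('r, 'x) chain_cplx \<Rightarrow> ('r, 'y) chain_cplx \<Rightarrow> (int \<Rightarrow> 'x \<Rightarrow> 'y) \<Rightarrow> bool"
  where "chain_map R X Y f \<longleftrightarrow>
    (\<forall>n. f n \<in> linear_maps R (Obj X n) (Obj Y n)) \<and>
    (\<forall>n. \<forall>x\<in>carrier (Obj X n). f (n + 1) (Dif X n x) = Dif Y n (f n x))"

definition chain_isomorphism ::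
    "('r, 'e) ring_scheme \<Rightarrow> ('r, 'x) chain_cplx \<Rightarrow> ('r, 'y) chain_cplx \<Rightarrow> (int \<Rightarrow> 'x \<Rightarrow> 'y) \<Rightarrow> bool"
  where "chain_isomorphism R X Y f \<longleftrightarrow>
    chain_map R X Y f \<and> (\<forall>n. bij_betw (f n) (carrier (Obj X n)) (carrier (Obj Y n)))"

definition chain_homotopic ::
    "('r, 'e) ring_scheme \<Rightarrow> ('r, 'x) chain_cplx \<Rightarrow> ('r, 'y) chain_cplx
      \<Rightarrow> (int \<Rightarrow> 'x \<Rightarrow> 'y) \<Rightarrow> (int \<Rightarrow> 'x \<Rightarrow> 'y) \<Rightarrow> bool"
  where "chain_homotopic R X Y f g \<longleftrightarrow>
    (\<exists>\<Psi>. (\<forall>i. \<Psi> i \<in> linear_maps R (Obj X i) (Obj Y (i - 1))) \<and>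
         (\<forall>i. \<forall>x\<in>carrier (Obj X i).
            f i x \<ominus>\<^bsub>Obj Y i\<^esub> g i x = Dif Y (i - 1) (\<Psi> i x) \<oplus>\<^bsub>Obj Y i\<^esub> \<Psi> (i + 1) (Dif X i x)))"

definition homotopy_equivalence ::
    "('r, 'e) ring_scheme \<Rightarrow> ('r, 'x) chain_cplx \<Rightarrow> ('r, 'y) chain_cplx \<Rightarrow> (int \<Rightarrow> 'x \<Rightarrow> 'y) \<Rightarrow> bool"
  where "homotopy_equivalence R X Y f \<longleftrightarrow> chain_map R X Y f \<and>
    (\<exists>g. chain_map R Y X g \<and>
         chain_homotopic R X X (\<lambda>n. g n \<circ> f n) (\<lambda>n. id) \<and>
         chain_homotopic R Y Y (\<lambda>n. f n \<circ> g n) (\<lambda>n. id))"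

definition ring_complex :: "('r, 'e) ring_scheme \<Rightarrow> ('r, 'r) chain_cplx"
  where "ring_complex R =
    \<lparr>Obj = (\<lambda>n. if n = 0 then ring_module R else (ring_module R)\<lparr>carrier := {\<zero>\<^bsub>R\<^esub>}\<rparr>),
     Dif = (\<lambda>n x. \<zero>\<^bsub>R\<^esub>)\<rparr>"

definition cohomology :: "('r, 'm) chain_cplx \<Rightarrow> int \<Rightarrow> ('r, 'm set) module"
  where "cohomology X n =
    quotient_module ((Obj X n)\<lparr>carrier := a_kernel (Obj X n) (Obj X (n + 1)) (Dif X n)\<rparr>)
      (Dif X (n - 1) ` carrier (Obj X (n - 1)))"

definition cohomology_complex :: "('r, 'm) chain_cplx \<Rightarrow> ('r, 'm set) chain_cplx"
  where "cohomology_complex X =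
    \<lparr>Obj = cohomology X, Dif = (\<lambda>n x. \<zero>\<^bsub>cohomology X (n + 1)\<^esub>)\<rparr>"


section \<open>Tensor products of complexes\<close>

definition neg_one_pow :: "('r, 'm, 'c) module_scheme \<Rightarrow> int \<Rightarrow> 'm \<Rightarrow> 'm"
  where "neg_one_pow M k x = (if even k then x else \<ominus>\<^bsub>M\<^esub> x)"

text \<open>The component of an element of degree \<open>n\<close> at index \<open>i\<close> lies in \<open>X\<^sub>i \<otimes> Y\<^sub>n\<^sub>-\<^sub>i\<close>. The
  differential is given by \<open>d (x \<otimes> y) = d x \<otimes> y + (-1)\<^sup>i x \<otimes> d y\<close> for \<open>x\<close> of degree \<open>i\<close>.\<close>

definition tensor_complex ::
    "('r, 'e) ring_scheme \<Rightarrow> ('r, 'x) chain_cplx \<Rightarrow> ('r, 'y) chain_cplx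
      \<Rightarrow> ('r, int \<Rightarrow> ('x \<times> 'y \<Rightarrow> 'r) set) chain_cplx"
  where "tensor_complex R X Y =
    \<lparr>Obj = (\<lambda>n. direct_sum (\<lambda>i. tensor R (Obj X i) (Obj Y (n - i)))),
     Dif = (\<lambda>n t k. let T = tensor R (Obj X k) (Obj Y (n + 1 - k)) in
        tensor_map R (Obj X k) (Obj Y (n + 1 - k)) (Dif X (k - 1)) id (t (k - 1))
        \<oplus>\<^bsub>T\<^esub> neg_one_pow T k
              (tensor_map R (Obj X k) (Obj Y (n + 1 - k)) id (Dif Y (n - k)) (t k)))\<rparr>"

text \<open>\<open>tensor_chain_map R X' Y' f g\<close> is \<open>f \<otimes> g : X \<otimes> Y \<rightarrow> X' \<otimes> Y'\<close>.\<close>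

definition tensor_chain_map ::
    "('r, 'e) ring_scheme \<Rightarrow> ('r, 'x2) chain_cplx \<Rightarrow> ('r, 'y2) chain_cplx
      \<Rightarrow> (int \<Rightarrow> 'x1 \<Rightarrow> 'x2) \<Rightarrow> (int \<Rightarrow> 'y1 \<Rightarrow> 'y2)
      \<Rightarrow> int \<Rightarrow> (int \<Rightarrow> ('x1 \<times> 'y1 \<Rightarrow> 'r) set) \<Rightarrow> int \<Rightarrow> ('x2 \<times> 'y2 \<Rightarrow> 'r) set"
  where "tensor_chain_map R X' Y' f g n t =
    (\<lambda>i. tensor_map R (Obj X' i) (Obj Y' (n - i)) (f i) (g (n - i)) (t i))"


section \<open>Categorified eigenvalues\<close>

text \<open>A scalar object commutes with every object under the tensor product, naturally. A HOL
  definition cannot quantify over types, so the element type \<open>'t\<close> of the complexes tested against is a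
  parameter; statements about scalar objects are meant to be universal in \<open>'t\<close>.\<close>

definition scalar_object ::
    "'t itself \<Rightarrow> ('r, 'e) ring_scheme \<Rightarrow> ('r, 'l) chain_cplx \<Rightarrow> bool"
  where "scalar_object _ R L \<longleftrightarrow>
    (\<exists>\<tau> :: ('r, 't) chain_cplx \<Rightarrow> int \<Rightarrow> (int \<Rightarrow> ('l \<times> 't \<Rightarrow> 'r) set) \<Rightarrow> (int \<Rightarrow> ('t \<times> 'l \<Rightarrow> 'r) set).
       (\<forall>X. fg_free_complex R X \<longrightarrow>
          chain_isomorphism R (tensor_complex R L X) (tensor_complex R X L) (\<tau> X)) \<and>
       (\<forall>X Y f. fg_free_complex R X \<longrightarrow> fg_free_complex R Y \<longrightarrow> chain_map R X Y f \<longrightarrow>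
          (\<forall>n. \<forall>t\<in>carrier (Obj (tensor_complex R L X) n).
             \<tau> Y n (tensor_chain_map R L Y (\<lambda>n. id) f n t)
             = tensor_chain_map R Y L f (\<lambda>n. id) n (\<tau> X n t))))"

definition nonzero_complex :: "('r, 'm) chain_cplx \<Rightarrow> bool"
  where "nonzero_complex X \<longleftrightarrow> (\<exists>n. carrier (Obj X n) \<noteq> {\<zero>\<^bsub>Obj X n\<^esub>})"

definition categorified_eigenvalue ::
    "'t itself \<Rightarrow> ('r, 'e) ring_scheme \<Rightarrow> ('r, 'm) chain_cplx \<Rightarrow> ('r, 'l) chain_cplx
      \<Rightarrow> ('r, 'v) chain_cplx \<Rightarrow> bool"
  where "categorified_eigenvalue T R F L V \<longleftrightarrow>
    fg_free_complex R F \<and> fg_free_complex R L \<and> scalar_object T R L \<and>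
    fg_free_complex R V \<and> nonzero_complex V \<and>
    (\<exists>\<alpha>. chain_map R L F \<alpha> \<and>
         homotopy_equivalence R (tensor_complex R L V) (tensor_complex R F V)
           (tensor_chain_map R F V \<alpha> (\<lambda>n. id)))"

end

theory Submission
  imports Defs
begin

text \<open>Let \<open>\<pi>\<close> be the projection of \<open>F\<^sub>n\<close> onto \<open>Im d\<close> along \<open>G\<^sub>n\<close>. As \<open>F\<^sub>n\<^sub>+\<^sub>1\<close> is free, \<open>\<pi>\<close> lifts
  to \<open>\<sigma> : F\<^sub>n\<^sub>+\<^sub>1 \<rightarrow> F\<^sub>n\<close> with \<open>d \<sigma> = \<pi>\<close>, and \<open>p = 1 - \<sigma> d\<close> is a projection onto the cocycles. The maps
  \<open>\<alpha> [x] = x - \<pi> x\<close> and \<open>g x = [p x]\<close> satisfy \<open>g \<alpha> = 1\<close> and \<open>\<alpha> g - 1 = d \<Psi> + \<Psi> d\<close> with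
  \<open>\<Psi> = - \<sigma> p\<close>, so \<open>\<alpha> : H(F) \<rightarrow> F\<close> is a homotopy equivalence already before tensoring, and
  \<open>_ \<otimes> id\<close> preserves homotopy equivalences. Every complex is a scalar object through
  the symmetric braiding with Koszul signs.\<close>

section \<open>Linear maps and submodules\<close>

text \<open>The splitting and the freeness enter at different places. \<open>G_n\<close> supplies an
  endomorphism \<pi> of \<open>F_n\<close> onto the boundaries; freeness of \<open>F_(n+1)\<close>
  then lifts \<pi> itself through d, so \<sigma> is linear on all of \<open>F_(n+1)\<close> and one
  never has to argue that the boundaries, a summand of a free module, are projective. From d
  \<sigma> d = \<pi> d = d it follows that \<sigma> d is idempotent with kernel the cocycles, which
  makes the cocycles a summand as well. The homotopy is -\<sigma> p rather than -\<sigma> because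
  \<sigma> is not normalised: \<pi> \<sigma> d may be nonzero, and p accounts for exactly this term.
  The form of the proof is shaped by two facts. Maps are total functions that matter on carriers
  only, so identities between them are pointwise on carriers and cannot simply be rewritten inside a
  tensor product. Modules are indexed by integer terms, so \<open>n - 1 + 1\<close> and
  \<open>n\<close> have to be matched by explicit equations before maps can be composed.\<close>

lemma linear_mapsI:
  assumes "\<And>x. x \<in> carrier M \<Longrightarrow> f x \<in> carrier N"
    and "\<And>x y. x \<in> carrier M \<Longrightarrow> y \<in> carrier M \<Longrightarrow> f (x \<oplus>\<^bsub>M\<^esub> y) = f x \<oplus>\<^bsub>N\<^esub> f y"
    and "\<And>a x. a \<in> carrier R \<Longrightarrow> x \<in> carrier M \<Longrightarrow> f (a \<odot>\<^bsub>M\<^esub> x) = a \<odot>\<^bsub>N\<^esub> f x"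
  shows "f \<in> linear_maps R M N"
  using assms by (auto simp: linear_maps_def)

lemma linear_maps_closed:
  "f \<in> linear_maps R M N \<Longrightarrow> x \<in> carrier M \<Longrightarrow> f x \<in> carrier N"
  by (auto simp: linear_maps_def)

lemma linear_maps_add:
  "f \<in> linear_maps R M N \<Longrightarrow> x \<in> carrier M \<Longrightarrow> y \<in> carrier M \<Longrightarrow> f (x \<oplus>\<^bsub>M\<^esub> y) = f x \<oplus>\<^bsub>N\<^esub> f y"
  by (auto simp: linear_maps_def)

lemma linear_maps_smult:
  "f \<in> linear_maps R M N \<Longrightarrow> a \<in> carrier R \<Longrightarrow> x \<in> carrier M \<Longrightarrow> f (a \<odot>\<^bsub>M\<^esub> x) = a \<odot>\<^bsub>N\<^esub> f x"
  by (auto simp: linear_maps_def)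

lemma linear_maps_abelian_group_hom:
  assumes "module R M" "module R N" "f \<in> linear_maps R M N"
  shows "abelian_group_hom M N f"
proof -
  interpret M: module R M by fact
  interpret N: module R N by fact
  show ?thesis
    using M.a_group N.a_group
    by (intro abelian_group_homI M.abelian_group_axioms N.abelian_group_axioms)
      (auto simp: group_hom_def group_hom_axioms_def hom_def
        linear_maps_closed[OF assms(3)] linear_maps_add[OF assms(3)])
qed

lemma linear_maps_zero:
  assumes "module R M" "module R N" "f \<in> linear_maps R M N"
  shows "f \<zero>\<^bsub>M\<^esub> = \<zero>\<^bsub>N\<^esub>"
  by (rule abelian_group_hom.hom_zero[OF linear_maps_abelian_group_hom[OF assms]])

lemma linear_maps_a_inv:
  assumes "module R M" "module R N" "f \<in> linear_maps R M N" "x \<in> carrier M"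
  shows "f (\<ominus>\<^bsub>M\<^esub> x) = \<ominus>\<^bsub>N\<^esub> f x"
  by (rule abelian_group_hom.hom_a_inv[OF linear_maps_abelian_group_hom[OF assms(1-3)] assms(4)])

lemma linear_maps_minus:
  assumes "module R M" "module R N" "f \<in> linear_maps R M N" "x \<in> carrier M" "y \<in> carrier M"
  shows "f (x \<ominus>\<^bsub>M\<^esub> y) = f x \<ominus>\<^bsub>N\<^esub> f y"
proof -
  interpret M: module R M by fact
  show ?thesis
    using assms by (simp add: a_minus_def linear_maps_add linear_maps_a_inv)
qed

lemma linear_maps_comp:
  "f \<in> linear_maps R M N \<Longrightarrow> g \<in> linear_maps R N P \<Longrightarrow> (\<lambda>x. g (f x)) \<in> linear_maps R M P"
  by (auto simp: linear_maps_def Pi_def)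

lemma linear_maps_id: "id \<in> linear_maps R M M"
  by (auto simp: linear_maps_def)

lemma linear_maps_const_zero:
  assumes "module R N" shows "(\<lambda>x. \<zero>\<^bsub>N\<^esub>) \<in> linear_maps R M N"
proof -
  interpret N: module R N by fact
  show ?thesis by (rule linear_mapsI) auto
qed

lemma linear_maps_sum:
  assumes "module R N" "f \<in> linear_maps R M N" "g \<in> linear_maps R M N"
  shows "(\<lambda>x. f x \<oplus>\<^bsub>N\<^esub> g x) \<in> linear_maps R M N"
proof -
  interpret N: module R N by fact
  show ?thesis
    by (rule linear_mapsI)
      (auto simp: linear_maps_closed[OF assms(2)] linear_maps_closed[OF assms(3)]
        linear_maps_add[OF assms(2)] linear_maps_add[OF assms(3)]
        linear_maps_smult[OF assms(2)] linear_maps_smult[OF assms(3)] N.a_ac N.smult_r_distr)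
qed

lemma linear_maps_uminus:
  assumes "module R N" "f \<in> linear_maps R M N"
  shows "(\<lambda>x. \<ominus>\<^bsub>N\<^esub> f x) \<in> linear_maps R M N"
proof -
  interpret N: module R N by fact
  show ?thesis
    by (rule linear_mapsI)
      (auto simp: linear_maps_closed[OF assms(2)] linear_maps_add[OF assms(2)]
        linear_maps_smult[OF assms(2)] N.smult_r_minus N.minus_add)
qed

lemma linear_maps_diff:
  assumes "module R N" "f \<in> linear_maps R M N" "g \<in> linear_maps R M N"
  shows "(\<lambda>x. f x \<ominus>\<^bsub>N\<^esub> g x) \<in> linear_maps R M N"
  unfolding a_minus_def by (intro linear_maps_sum linear_maps_uminus assms)

lemma submodule_equalizer:
  assumes "module R M" "module R N" "f \<in> linear_maps R M N" "g \<in> linear_maps R M N"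
  shows "submodule {x \<in> carrier M. f x = g x} R M"
proof -
  interpret M: module R M by fact
  show ?thesis
    by (rule M.submoduleI)
      (auto simp: linear_maps_zero[OF assms(1,2)] linear_maps_a_inv[OF assms(1,2)]
        assms(3,4) linear_maps_add[OF assms(3)] linear_maps_add[OF assms(4)]
        linear_maps_smult[OF assms(3)] linear_maps_smult[OF assms(4)])
qed

lemma submodule_kernel:
  assumes "module R M" "module R N" "f \<in> linear_maps R M N"
  shows "submodule (a_kernel M N f) R M"
  using submodule_equalizer[OF assms linear_maps_const_zero[OF assms(2)]]
  by (simp add: a_kernel_def' )

lemma submodule_image:
  assumes "module R M" "module R N" "f \<in> linear_maps R M N"
  shows "submodule (f ` carrier M) R N"
proof -
  interpret M: module R M by fact
  interpret N: module R N by fact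
  have "\<zero>\<^bsub>N\<^esub> = f \<zero>\<^bsub>M\<^esub>"
    by (simp add: linear_maps_zero[OF assms])
  then show ?thesis
    by (intro N.submoduleI)
      (auto simp: linear_maps_closed[OF assms(3)] linear_maps_a_inv[OF assms, symmetric]
        linear_maps_add[OF assms(3), symmetric] linear_maps_smult[OF assms(3), symmetric])
qed

text \<open>Cohomology divides the boundaries out of the module of cocycles, so the boundaries are
  needed as a submodule of that smaller module and not only of the ambient one.\<close>

lemma submodule_restrict_carrier:
  assumes "module R M" "submodule K R M" "submodule N R M" "N \<subseteq> K"
  shows "submodule N R (M\<lparr>carrier := K\<rparr>)"
proof -
  interpret M: module R M by fact
  interpret K: module R "M\<lparr>carrier := K\<rparr>"
    by (rule submodule.submodule_is_module[OF assms(2,1)])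
  show ?thesis
    using submodule.submodule_is_module[OF assms(3,1)] assms(4)
    by (intro K.module_incl_imp_submodule) auto
qed

section \<open>Generated submodules\<close>

lemma submodule_Inter:
  assumes "module R M" "\<S> \<noteq> {}" "\<And>N. N \<in> \<S> \<Longrightarrow> submodule N R M"
  shows "submodule (\<Inter>\<S>) R M"
proof -
  interpret M: module R M by fact
  have "\<zero>\<^bsub>M\<^esub> \<in> N" if "N \<in> \<S>" for N
    using subgroup.one_closed[OF submodule.axioms(1)[OF assms(3)[OF that]]] by simp
  moreover have "N \<subseteq> carrier M" if "N \<in> \<S>" for N
    by (rule M.submoduleE(1)[OF assms(3)[OF that]])
  ultimately show ?thesis
    using assms(2)
    by (intro M.submoduleI) (auto intro: M.submoduleE(3-5)[OF assms(3)])
qed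

text \<open>Since \<open>S \<subseteq> carrier M\<close>, the carrier belongs to the intersected
  family. This matters because an empty intersection would be the whole type.\<close>

lemma submodule_generated:
  assumes "module R M" "S \<subseteq> carrier M"
  shows "submodule (generated_submodule R M S) R M"
  unfolding generated_submodule_def
  using assms module.carrier_is_submodule[OF assms(1)]
  by (intro submodule_Inter) auto

lemma generated_submodule_incl: "S \<subseteq> generated_submodule R M S"
  by (auto simp: generated_submodule_def)

lemma generated_submodule_minimal:
  "submodule N R M \<Longrightarrow> S \<subseteq> N \<Longrightarrow> generated_submodule R M S \<subseteq> N"
  by (auto simp: generated_submodule_def)

section \<open>Quotient modules\<close>

lemma submodule_abelian_subgroup:
  assumes "module R M" "submodule N R M"
  shows "abelian_subgroup N M"
proof -
  interpret M: module R M by fact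
  show ?thesis
    using submodule.axioms(1)[OF assms(2)]
    by (intro abelian_subgroupI3 additive_subgroup.intro) (auto intro: M.abelian_group_axioms)
qed

lemma carrier_quotient: "carrier (quotient_module M N) = (\<lambda>x. N +>\<^bsub>M\<^esub> x) ` carrier M"
  by (auto simp: quotient_module_def A_RCOSETS_def')

lemma coset_eq_iff:
  assumes "module R M" "submodule N R M" "x \<in> carrier M" "y \<in> carrier M"
  shows "N +>\<^bsub>M\<^esub> x = N +>\<^bsub>M\<^esub> y \<longleftrightarrow> x \<ominus>\<^bsub>M\<^esub> y \<in> N"
proof -
  interpret M: module R M by fact
  interpret N: abelian_subgroup N M by (rule submodule_abelian_subgroup) fact+
  show ?thesis
  proof
    assume "N +>\<^bsub>M\<^esub> x = N +>\<^bsub>M\<^esub> y"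
    then have "x \<in> N +>\<^bsub>M\<^esub> y"
      using N.a_rcos_self[OF assms(3)] by simp
    then show "x \<ominus>\<^bsub>M\<^esub> y \<in> N"
      using N.a_rcos_module_imp[OF assms(4)] assms(3,4) by (simp add: a_minus_def)
  next
    assume "x \<ominus>\<^bsub>M\<^esub> y \<in> N"
    then have "x \<in> N +>\<^bsub>M\<^esub> y"
      using N.a_rcos_module_rev[OF assms(4,3)] by (simp add: a_minus_def)
    then show "N +>\<^bsub>M\<^esub> x = N +>\<^bsub>M\<^esub> y"
      using N.a_repr_independence' assms(4) by metis
  qed
qed

lemma quotient_add:
  assumes "module R M" "submodule N R M" "x \<in> carrier M" "y \<in> carrier M"
  shows "(N +>\<^bsub>M\<^esub> x) \<oplus>\<^bsub>quotient_module M N\<^esub> (N +>\<^bsub>M\<^esub> y) = N +>\<^bsub>M\<^esub> (x \<oplus>\<^bsub>M\<^esub> y)"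
proof -
  interpret N: abelian_subgroup N M by (rule submodule_abelian_subgroup) fact+
  show ?thesis using assms by (simp add: quotient_module_def N.a_rcos_sum)
qed

text \<open>The scalar action is a union over all representatives. Two representatives differ by an
  element of \<open>N\<close>, which stays in \<open>N\<close> after scaling, so every set in the
  union is the same coset.\<close>

lemma quotient_smult:
  assumes "module R M" "submodule N R M" "a \<in> carrier R" "x \<in> carrier M"
  shows "a \<odot>\<^bsub>quotient_module M N\<^esub> (N +>\<^bsub>M\<^esub> x) = N +>\<^bsub>M\<^esub> (a \<odot>\<^bsub>M\<^esub> x)"
proof -
  interpret M: module R M by fact
  interpret N: abelian_subgroup N M by (rule submodule_abelian_subgroup) fact+
  have const: "N +>\<^bsub>M\<^esub> (a \<odot>\<^bsub>M\<^esub> y) = N +>\<^bsub>M\<^esub> (a \<odot>\<^bsub>M\<^esub> x)" if y: "y \<in> N +>\<^bsub>M\<^esub> x" for y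
  proof -
    have yM: "y \<in> carrier M"
      using y assms(4) by (rule N.a_elemrcos_carrier[rotated])
    have "y \<ominus>\<^bsub>M\<^esub> x \<in> N"
      using N.a_rcos_module_imp[OF assms(4) y] by (simp add: a_minus_def)
    then have "a \<odot>\<^bsub>M\<^esub> (y \<ominus>\<^bsub>M\<^esub> x) \<in> N"
      by (rule submodule.smult_closed[OF assms(2,3)])
    then show ?thesis
      using assms yM
      by (simp add: coset_eq_iff a_minus_def M.smult_r_distr M.smult_r_minus)
  qed
  have "N +>\<^bsub>M\<^esub> x \<noteq> {}"
    using N.a_rcos_self[OF assms(4)] by blast
  then have "(\<Union>y\<in>N +>\<^bsub>M\<^esub> x. N +>\<^bsub>M\<^esub> (a \<odot>\<^bsub>M\<^esub> y)) = N +>\<^bsub>M\<^esub> (a \<odot>\<^bsub>M\<^esub> x)"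
    by (rule SUP_eq_const) (rule const)
  then show ?thesis
    by (simp add: quotient_module_def)
qed

lemma quotient_zero:
  assumes "module R M" "submodule N R M"
  shows "\<zero>\<^bsub>quotient_module M N\<^esub> = N +>\<^bsub>M\<^esub> \<zero>\<^bsub>M\<^esub>"
proof -
  interpret M: module R M by fact
  interpret N: abelian_subgroup N M by (rule submodule_abelian_subgroup) fact+
  show ?thesis by (simp add: quotient_module_def N.a_subset)
qed

lemma quotient_proj_linear:
  assumes "module R M" "submodule N R M"
  shows "(\<lambda>x. N +>\<^bsub>M\<^esub> x) \<in> linear_maps R M (quotient_module M N)"
  by (rule linear_mapsI) (auto simp: carrier_quotient quotient_add[OF assms] quotient_smult[OF assms])

lemma module_quotient:
  assumes "module R M" "submodule N R M"
  shows "module R (quotient_module M N)"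
proof -
  interpret M: module R M by fact
  note simps = carrier_quotient quotient_add[OF assms] quotient_smult[OF assms] quotient_zero[OF assms]
  show ?thesis
  proof (rule moduleI)
    show "abelian_group (quotient_module M N)"
    proof (rule abelian_groupI)
      fix A assume "A \<in> carrier (quotient_module M N)"
      then obtain x where x: "x \<in> carrier M" "A = N +>\<^bsub>M\<^esub> x" by (auto simp: simps)
      then have "(N +>\<^bsub>M\<^esub> (\<ominus>\<^bsub>M\<^esub> x)) \<oplus>\<^bsub>quotient_module M N\<^esub> A = \<zero>\<^bsub>quotient_module M N\<^esub>"
        by (simp add: simps M.l_neg)
      then show "\<exists>B\<in>carrier (quotient_module M N). B \<oplus>\<^bsub>quotient_module M N\<^esub> A = \<zero>\<^bsub>quotient_module M N\<^esub>"
        using x by (auto simp: carrier_quotient)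
    qed (auto simp: simps M.a_ac)
  qed (auto simp: simps M.R.is_cring M.smult_l_distr M.smult_r_distr M.smult_assoc1)
qed

text \<open>As \<open>f\<close> kills \<open>N\<close>, it is constant on a coset, and the image of
  the coset is a singleton, the case in which \<open>the_elem\<close> has a specified value.\<close>

lemma quotient_lift_coset:
  assumes "module R M" "submodule N R M" "module R P" "f \<in> linear_maps R M P"
    and "\<And>x. x \<in> N \<Longrightarrow> f x = \<zero>\<^bsub>P\<^esub>" "x \<in> carrier M"
  shows "the_elem (f ` (N +>\<^bsub>M\<^esub> x)) = f x"
proof -
  interpret M: module R M by fact
  interpret P: module R P by fact
  interpret N: abelian_subgroup N M by (rule submodule_abelian_subgroup) fact+
  have "f y = f x" if "y \<in> N +>\<^bsub>M\<^esub> x" for y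
    using that assms(5,6) N.a_subset
    by (auto simp: a_r_coset_def' linear_maps_add[OF assms(4)] linear_maps_closed[OF assms(4)])
  then have "f ` (N +>\<^bsub>M\<^esub> x) = {f x}"
    using N.a_rcos_self[OF assms(6)] by blast
  then show ?thesis by simp
qed

lemma quotient_lift_linear:
  assumes "module R M" "submodule N R M" "module R P" "f \<in> linear_maps R M P"
    and "\<And>x. x \<in> N \<Longrightarrow> f x = \<zero>\<^bsub>P\<^esub>"
  shows "(\<lambda>A. the_elem (f ` A)) \<in> linear_maps R (quotient_module M N) P"
proof -
  interpret M: module R M by fact
  show ?thesis
    by (rule linear_mapsI)
      (auto simp: carrier_quotient quotient_add[OF assms(1,2)] quotient_smult[OF assms(1,2)]
        quotient_lift_coset[OF assms] linear_maps_closed[OF assms(4)]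
        linear_maps_add[OF assms(4)] linear_maps_smult[OF assms(4)])
qed

section \<open>Free modules on a set\<close>

lemma free_module_simps:
  "p \<in> carrier (free_module R S) \<longleftrightarrow>
     (\<forall>z. p z \<in> carrier R) \<and> {z. p z \<noteq> \<zero>\<^bsub>R\<^esub>} \<subseteq> S \<and> finite {z. p z \<noteq> \<zero>\<^bsub>R\<^esub>}"
  "\<zero>\<^bsub>free_module R S\<^esub> = (\<lambda>z. \<zero>\<^bsub>R\<^esub>)"
  "p \<oplus>\<^bsub>free_module R S\<^esub> q = (\<lambda>z. p z \<oplus>\<^bsub>R\<^esub> q z)"
  "a \<odot>\<^bsub>free_module R S\<^esub> p = (\<lambda>z. a \<otimes>\<^bsub>R\<^esub> p z)"
  by (simp_all add: free_module_def)

lemma module_free_module: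
  assumes "cring R" shows "module R (free_module R S)"
proof -
  interpret R: cring R by fact
  have sub: "p \<oplus>\<^bsub>free_module R S\<^esub> q \<in> carrier (free_module R S)"
    if "p \<in> carrier (free_module R S)" "q \<in> carrier (free_module R S)" for p q
  proof -
    have "{z. p z \<oplus>\<^bsub>R\<^esub> q z \<noteq> \<zero>\<^bsub>R\<^esub>} \<subseteq> {z. p z \<noteq> \<zero>\<^bsub>R\<^esub>} \<union> {z. q z \<noteq> \<zero>\<^bsub>R\<^esub>}"
      by auto
    then show ?thesis
      using that finite_subset by (auto simp: free_module_simps)
  qed
  have smult: "a \<odot>\<^bsub>free_module R S\<^esub> p \<in> carrier (free_module R S)"
    if "a \<in> carrier R" "p \<in> carrier (free_module R S)" for a p
  proof -
    have "{z. a \<otimes>\<^bsub>R\<^esub> p z \<noteq> \<zero>\<^bsub>R\<^esub>} \<subseteq> {z. p z \<noteq> \<zero>\<^bsub>R\<^esub>}"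
      using that by auto
    then show ?thesis
      using that finite_subset by (auto simp: free_module_simps)
  qed
  show ?thesis
  proof (rule moduleI)
    show "abelian_group (free_module R S)"
    proof (rule abelian_groupI)
      fix p assume p: "p \<in> carrier (free_module R S)"
      then have "(\<lambda>z. \<ominus>\<^bsub>R\<^esub> p z) \<in> carrier (free_module R S)"
        by (auto simp: free_module_simps)
      then show "\<exists>q\<in>carrier (free_module R S). q \<oplus>\<^bsub>free_module R S\<^esub> p = \<zero>\<^bsub>free_module R S\<^esub>"
        using p by (intro bexI[where x = "\<lambda>z. \<ominus>\<^bsub>R\<^esub> p z"]) (auto simp: free_module_simps R.l_neg)
    qed (use sub in \<open>auto simp: free_module_simps R.a_ac\<close>)
  qed (use smult in \<open>auto simp: free_module_simps assms R.l_distr R.r_distr R.m_assoc\<close>)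
qed

lemma free_gen_closed:
  assumes "cring R" "z \<in> S" shows "free_gen R z \<in> carrier (free_module R S)"
proof -
  interpret R: cring R by fact
  have "{w. free_gen R z w \<noteq> \<zero>\<^bsub>R\<^esub>} \<subseteq> {z}"
    by (auto simp: free_gen_def)
  then show ?thesis
    using assms(2) finite_subset by (auto simp: free_module_simps free_gen_def)
qed

text \<open>The induction runs over a finite set \<open>T\<close> containing the support; erasing
  the value at one point of \<open>T\<close> leaves a function supported on the rest.
  \<open>T\<close> is not assumed to lie in \<open>S\<close>, and at a point outside
  \<open>S\<close> there is nothing to erase.\<close>

lemma free_module_induct [consumes 2, case_names zero gen add smult]:
  assumes "cring R" "p \<in> carrier (free_module R S)"
    and "Q \<zero>\<^bsub>free_module R S\<^esub>"
    and "\<And>z. z \<in> S \<Longrightarrow> Q (free_gen R z)"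
    and add: "\<And>p q. p \<in> carrier (free_module R S) \<Longrightarrow> q \<in> carrier (free_module R S) \<Longrightarrow> Q p \<Longrightarrow> Q q
      \<Longrightarrow> Q (p \<oplus>\<^bsub>free_module R S\<^esub> q)"
    and smult: "\<And>a p. a \<in> carrier R \<Longrightarrow> p \<in> carrier (free_module R S) \<Longrightarrow> Q p
      \<Longrightarrow> Q (a \<odot>\<^bsub>free_module R S\<^esub> p)"
  shows "Q p"
proof -
  interpret R: cring R by fact
  interpret P: module R "free_module R S" by (rule module_free_module) fact
  have "Q p" if "finite T" "{z. p z \<noteq> \<zero>\<^bsub>R\<^esub>} \<subseteq> T" "p \<in> carrier (free_module R S)" for T p
    using that
  proof (induction T arbitrary: p rule: finite_induct)
    case empty
    then have "p = \<zero>\<^bsub>free_module R S\<^esub>" by (auto simp: free_module_simps)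
    then show ?case using assms(3) by simp
  next
    case (insert w T)
    define q where "q = p(w := \<zero>\<^bsub>R\<^esub>)"
    have supp: "{z. q z \<noteq> \<zero>\<^bsub>R\<^esub>} \<subseteq> {z. p z \<noteq> \<zero>\<^bsub>R\<^esub>}" "{z. q z \<noteq> \<zero>\<^bsub>R\<^esub>} \<subseteq> T"
      using insert.prems by (auto simp: q_def)
    have q: "q \<in> carrier (free_module R S)"
      using insert.prems(2) supp(1) finite_subset[OF supp(1)] by (auto simp: free_module_simps q_def)
    then have Qq: "Q q" using supp(2) by (intro insert.IH)
    show ?case
    proof (cases "w \<in> S")
      case True
      have "p w \<in> carrier R" using insert.prems(2) by (simp add: free_module_simps)
      moreover have "p = (p w \<odot>\<^bsub>free_module R S\<^esub> free_gen R w) \<oplus>\<^bsub>free_module R S\<^esub> q"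
        using insert.prems(2) by (auto simp: free_module_simps q_def free_gen_def)
      ultimately show ?thesis
        using add[of "p w \<odot>\<^bsub>free_module R S\<^esub> free_gen R w" q] smult[of "p w" "free_gen R w"] True
          Qq q assms(4) free_gen_closed[OF assms(1) True] P.smult_closed by metis
    next
      case False
      then have "p w = \<zero>\<^bsub>R\<^esub>" using insert.prems(2) by (auto simp: free_module_simps)
      then have "q = p" by (simp add: q_def fun_upd_idem)
      then show ?thesis using Qq by simp
    qed
  qed
  then show ?thesis using assms(2) by (auto simp: free_module_simps)
qed

section \<open>Universal property of the free module on a set\<close>

definition linear_extension ::
    "('r, 'e) ring_scheme \<Rightarrow> ('r, 'p, 'f) module_scheme \<Rightarrow> ('s \<Rightarrow> 'p) \<Rightarrow> ('s \<Rightarrow> 'r) \<Rightarrow> 'p"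
  where "linear_extension R P b p = (\<Oplus>\<^bsub>P\<^esub>z\<in>{z. p z \<noteq> \<zero>\<^bsub>R\<^esub>}. p z \<odot>\<^bsub>P\<^esub> b z)"

text \<open>Coefficients outside the support contribute zero. The freedom in \<open>T\<close> is
  what linearity requires: the support of a sum can shrink by cancellation and that of a multiple by
  zero divisors, so both sides are compared over a common index set.\<close>

lemma linear_extension_superset:
  assumes "module R P" "b \<in> S \<rightarrow> carrier P" "p \<in> carrier (free_module R S)"
    and "finite T" "T \<subseteq> S" "{z. p z \<noteq> \<zero>\<^bsub>R\<^esub>} \<subseteq> T"
  shows "linear_extension R P b p = (\<Oplus>\<^bsub>P\<^esub>z\<in>T. p z \<odot>\<^bsub>P\<^esub> b z)"
proof -
  interpret P: module R P by fact
  show ?thesis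
    unfolding linear_extension_def using assms(2-6)
    by (intro P.add.finprod_mono_neutral_cong_left) (auto simp: free_module_simps Pi_iff subset_iff)
qed

lemma linear_extension_linear:
  assumes "module R P" "b \<in> S \<rightarrow> carrier P"
  shows "linear_extension R P b \<in> linear_maps R (free_module R S) P"
proof -
  interpret P: module R P by fact
  interpret F: module R "free_module R S" by (rule module_free_module) (rule P.R.is_cring)
  show ?thesis
  proof (rule linear_mapsI)
    fix p assume "p \<in> carrier (free_module R S)"
    then show "linear_extension R P b p \<in> carrier P"
      unfolding linear_extension_def using assms(2)
      by (intro P.finsum_closed) (auto simp: free_module_simps)
  next
    fix p q assume pq: "p \<in> carrier (free_module R S)" "q \<in> carrier (free_module R S)"
    let ?T = "{z. p z \<noteq> \<zero>\<^bsub>R\<^esub>} \<union> {z. q z \<noteq> \<zero>\<^bsub>R\<^esub>}"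
    have T: "finite ?T" "?T \<subseteq> S" using pq by (auto simp: free_module_simps)
    have "linear_extension R P b (p \<oplus>\<^bsub>free_module R S\<^esub> q)
      = (\<Oplus>\<^bsub>P\<^esub>z\<in>?T. (p \<oplus>\<^bsub>free_module R S\<^esub> q) z \<odot>\<^bsub>P\<^esub> b z)"
      using pq T
      by (intro linear_extension_superset[OF assms F.a_closed]) (auto simp: free_module_simps(3))
    also have "\<dots> = (\<Oplus>\<^bsub>P\<^esub>z\<in>?T. (p z \<odot>\<^bsub>P\<^esub> b z) \<oplus>\<^bsub>P\<^esub> (q z \<odot>\<^bsub>P\<^esub> b z))"
      using pq T assms(2)
      by (intro P.finsum_cong') (auto simp: free_module_simps P.smult_l_distr Pi_iff subset_iff)
    also have "\<dots> = (\<Oplus>\<^bsub>P\<^esub>z\<in>?T. p z \<odot>\<^bsub>P\<^esub> b z) \<oplus>\<^bsub>P\<^esub> (\<Oplus>\<^bsub>P\<^esub>z\<in>?T. q z \<odot>\<^bsub>P\<^esub> b z)"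
      using pq T assms(2)
      by (intro P.finsum_addf) (auto simp: free_module_simps Pi_iff subset_iff)
    also have "\<dots> = linear_extension R P b p \<oplus>\<^bsub>P\<^esub> linear_extension R P b q"
      using linear_extension_superset[OF assms pq(1) T] linear_extension_superset[OF assms pq(2) T]
      by auto
    finally show "linear_extension R P b (p \<oplus>\<^bsub>free_module R S\<^esub> q)
      = linear_extension R P b p \<oplus>\<^bsub>P\<^esub> linear_extension R P b q" .
  next
    fix a p assume a: "a \<in> carrier R" and p: "p \<in> carrier (free_module R S)"
    let ?T = "{z. p z \<noteq> \<zero>\<^bsub>R\<^esub>}"
    have T: "finite ?T" "?T \<subseteq> S" using p by (auto simp: free_module_simps)
    have "linear_extension R P b (a \<odot>\<^bsub>free_module R S\<^esub> p)
      = (\<Oplus>\<^bsub>P\<^esub>z\<in>?T. (a \<odot>\<^bsub>free_module R S\<^esub> p) z \<odot>\<^bsub>P\<^esub> b z)"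
      using a p T
      by (intro linear_extension_superset[OF assms F.smult_closed]) (auto simp: free_module_simps(4))
    also have "\<dots> = (\<Oplus>\<^bsub>P\<^esub>z\<in>?T. a \<odot>\<^bsub>P\<^esub> (p z \<odot>\<^bsub>P\<^esub> b z))"
      using a p T assms(2)
      by (intro P.finsum_cong') (auto simp: free_module_simps P.smult_assoc1 Pi_iff subset_iff)
    also have "\<dots> = a \<odot>\<^bsub>P\<^esub> linear_extension R P b p"
      unfolding linear_extension_def using a p T assms(2)
      by (intro P.finsum_smult_ldistr[symmetric]) (auto simp: free_module_simps Pi_iff subset_iff)
    finally show "linear_extension R P b (a \<odot>\<^bsub>free_module R S\<^esub> p) = a \<odot>\<^bsub>P\<^esub> linear_extension R P b p" .
  qed
qed

lemma linear_extension_free_gen: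
  assumes "module R P" "b \<in> S \<rightarrow> carrier P" "z \<in> S"
  shows "linear_extension R P b (free_gen R z) = b z"
proof -
  interpret P: module R P by fact
  have "b z \<in> carrier P" using assms(2,3) by auto
  have "linear_extension R P b (free_gen R z) = (\<Oplus>\<^bsub>P\<^esub>w\<in>{z}. free_gen R z w \<odot>\<^bsub>P\<^esub> b w)"
    using assms(3)
    by (intro linear_extension_superset[OF assms(1,2) free_gen_closed[OF P.R.is_cring]])
      (auto simp: free_gen_def)
  also have "\<dots> = b z"
    using \<open>b z \<in> carrier P\<close> by (simp add: P.finsum_insert free_gen_def)
  finally show ?thesis .
qed

section \<open>Tensor products\<close>

definition bilinear_map ::
    "('r, 'e) ring_scheme \<Rightarrow> ('r, 'a, 'c) module_scheme \<Rightarrow> ('r, 'b, 'd) module_scheme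
      \<Rightarrow> ('r, 'p, 'f) module_scheme \<Rightarrow> ('a \<Rightarrow> 'b \<Rightarrow> 'p) \<Rightarrow> bool"
  where "bilinear_map R M N Q b \<longleftrightarrow>
    (\<forall>x\<in>carrier M. b x \<in> linear_maps R N Q) \<and> (\<forall>y\<in>carrier N. (\<lambda>x. b x y) \<in> linear_maps R M Q)"

lemma bilinear_map_linear1:
  "bilinear_map R M N Q b \<Longrightarrow> y \<in> carrier N \<Longrightarrow> (\<lambda>x. b x y) \<in> linear_maps R M Q"
  by (simp add: bilinear_map_def)

lemma bilinear_map_linear2:
  "bilinear_map R M N Q b \<Longrightarrow> x \<in> carrier M \<Longrightarrow> b x \<in> linear_maps R N Q"
  by (simp add: bilinear_map_def)

lemma bilinear_map_closed:
  "bilinear_map R M N Q b \<Longrightarrow> x \<in> carrier M \<Longrightarrow> y \<in> carrier N \<Longrightarrow> b x y \<in> carrier Q"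
  by (rule linear_maps_closed[OF bilinear_map_linear2])

abbreviation tensor_kernel ::
    "('r, 'e) ring_scheme \<Rightarrow> ('r, 'a, 'c) module_scheme \<Rightarrow> ('r, 'b, 'd) module_scheme
      \<Rightarrow> ('a \<times> 'b \<Rightarrow> 'r) set"
  where "tensor_kernel R M N \<equiv> generated_submodule R (tensor_pre R M N) (tensor_relations R M N)"

lemma tensor_relations_subset:
  assumes "module R M" "module R N"
  shows "tensor_relations R M N \<subseteq> carrier (tensor_pre R M N)"
proof -
  interpret M: module R M by fact
  interpret N: module R N by fact
  interpret P: module R "tensor_pre R M N" by (rule module_free_module) (rule M.R.is_cring)
  show ?thesis
    unfolding tensor_relations_def Let_def
    by (auto intro!: P.minus_closed P.a_closed P.smult_closed free_gen_closed[OF M.R.is_cring])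
qed

lemma submodule_tensor_kernel:
  assumes "module R M" "module R N"
  shows "submodule (tensor_kernel R M N) R (tensor_pre R M N)"
proof -
  interpret M: module R M by fact
  show ?thesis
    by (intro submodule_generated module_free_module tensor_relations_subset assms M.R.is_cring)
qed

lemma module_tensor:
  assumes "module R M" "module R N"
  shows "module R (tensor R M N)"
proof -
  interpret M: module R M by fact
  show ?thesis
    unfolding tensor_def
    by (intro module_quotient module_free_module submodule_tensor_kernel assms M.R.is_cring)
qed

text \<open>Each of the four laws is one of the four families of relations: the difference of the
  two representatives is a relation, hence lies in the submodule divided out.\<close>

lemma pure_tensor_bilinear:
  assumes "module R M" "module R N"
  shows "bilinear_map R M N (tensor R M N) (pure_tensor R M N)"
proof -
  interpret M: module R M by fact
  interpret N: module R N by fact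
  let ?P = "tensor_pre R M N" and ?K = "tensor_kernel R M N"
  have mP: "module R ?P" by (rule module_free_module) (rule M.R.is_cring)
  interpret P: module R ?P by (rule mP)
  note K = submodule_tensor_kernel[OF assms]
  have gen: "free_gen R (x, y) \<in> carrier ?P" if "x \<in> carrier M" "y \<in> carrier N" for x y
    using that by (intro free_gen_closed[OF M.R.is_cring]) auto
  have rel: "?K +>\<^bsub>?P\<^esub> p = ?K +>\<^bsub>?P\<^esub> q"
    if "p \<ominus>\<^bsub>?P\<^esub> q \<in> tensor_relations R M N" "p \<in> carrier ?P" "q \<in> carrier ?P" for p q
    using that generated_submodule_incl[of "tensor_relations R M N" R ?P]
    by (subst coset_eq_iff[OF mP K]) auto
  have closed: "pure_tensor R M N x y \<in> carrier (tensor R M N)"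
    if "x \<in> carrier M" "y \<in> carrier N" for x y
    using gen[OF that] by (auto simp: pure_tensor_def tensor_def carrier_quotient)
  have add1: "pure_tensor R M N (x \<oplus>\<^bsub>M\<^esub> x') y
      = pure_tensor R M N x y \<oplus>\<^bsub>tensor R M N\<^esub> pure_tensor R M N x' y"
    if "x \<in> carrier M" "x' \<in> carrier M" "y \<in> carrier N" for x x' y
    unfolding pure_tensor_def tensor_def quotient_add[OF mP K gen[OF that(1,3)] gen[OF that(2,3)]]
    by (intro rel, use that in \<open>unfold tensor_relations_def Let_def, blast\<close>)
      (use that in \<open>simp_all add: gen\<close>)
  have add2: "pure_tensor R M N x (y \<oplus>\<^bsub>N\<^esub> y')
      = pure_tensor R M N x y \<oplus>\<^bsub>tensor R M N\<^esub> pure_tensor R M N x y'"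
    if "x \<in> carrier M" "y \<in> carrier N" "y' \<in> carrier N" for x y y'
    unfolding pure_tensor_def tensor_def quotient_add[OF mP K gen[OF that(1,2)] gen[OF that(1,3)]]
    by (intro rel, use that in \<open>unfold tensor_relations_def Let_def, blast\<close>)
      (use that in \<open>simp_all add: gen\<close>)
  have smult1: "pure_tensor R M N (a \<odot>\<^bsub>M\<^esub> x) y = a \<odot>\<^bsub>tensor R M N\<^esub> pure_tensor R M N x y"
    if "a \<in> carrier R" "x \<in> carrier M" "y \<in> carrier N" for a x y
    unfolding pure_tensor_def tensor_def quotient_smult[OF mP K that(1) gen[OF that(2,3)]]
    by (intro rel, use that in \<open>unfold tensor_relations_def Let_def, blast\<close>)
      (use that in \<open>simp_all add: gen\<close>)
  have smult2: "pure_tensor R M N x (a \<odot>\<^bsub>N\<^esub> y) = a \<odot>\<^bsub>tensor R M N\<^esub> pure_tensor R M N x y"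
    if "a \<in> carrier R" "x \<in> carrier M" "y \<in> carrier N" for a x y
    unfolding pure_tensor_def tensor_def quotient_smult[OF mP K that(1) gen[OF that(2,3)]]
    by (intro rel, use that in \<open>unfold tensor_relations_def Let_def, blast\<close>)
      (use that in \<open>simp_all add: gen\<close>)
  show ?thesis
    unfolding bilinear_map_def using closed add1 add2 smult1 smult2
    by (auto intro!: linear_mapsI)
qed

lemma pure_tensor_closed:
  assumes "module R M" "module R N" "x \<in> carrier M" "y \<in> carrier N"
  shows "pure_tensor R M N x y \<in> carrier (tensor R M N)"
  by (rule bilinear_map_closed[OF pure_tensor_bilinear[OF assms(1,2)] assms(3,4)])

text \<open>This is induction on the free module, carried along the projection, under which
  generators become pure tensors.\<close>

lemma tensor_induct [consumes 3, case_names pure add smult]: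
  assumes "module R M" "module R N" "t \<in> carrier (tensor R M N)"
    and pure: "\<And>x y. x \<in> carrier M \<Longrightarrow> y \<in> carrier N \<Longrightarrow> Q (pure_tensor R M N x y)"
    and add: "\<And>s t. s \<in> carrier (tensor R M N) \<Longrightarrow> t \<in> carrier (tensor R M N) \<Longrightarrow> Q s \<Longrightarrow> Q t
      \<Longrightarrow> Q (s \<oplus>\<^bsub>tensor R M N\<^esub> t)"
    and smult: "\<And>a t. a \<in> carrier R \<Longrightarrow> t \<in> carrier (tensor R M N) \<Longrightarrow> Q t
      \<Longrightarrow> Q (a \<odot>\<^bsub>tensor R M N\<^esub> t)"
  shows "Q t"
proof -
  interpret M: module R M by fact
  interpret N: module R N by fact
  let ?P = "tensor_pre R M N" and ?K = "tensor_kernel R M N"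
  have mP: "module R ?P" by (rule module_free_module) (rule M.R.is_cring)
  interpret P: module R ?P by (rule mP)
  interpret T: module R "tensor R M N" by (rule module_tensor) fact+
  note K = submodule_tensor_kernel[OF assms(1,2)]
  have proj: "(\<lambda>p. ?K +>\<^bsub>?P\<^esub> p) \<in> linear_maps R ?P (tensor R M N)"
    unfolding tensor_def by (rule quotient_proj_linear[OF mP K])
  obtain p where p: "p \<in> carrier ?P" "t = ?K +>\<^bsub>?P\<^esub> p"
    using assms(3) by (auto simp: tensor_def carrier_quotient)
  have "Q (?K +>\<^bsub>?P\<^esub> p)"
    using M.R.is_cring p(1)
  proof (induction rule: free_module_induct)
    case zero
    \<comment> \<open>Zero is reached as the zero multiple of a pure tensor, so the rule gets by
      with three cases.\<close>
    have "Q (\<zero>\<^bsub>R\<^esub> \<odot>\<^bsub>tensor R M N\<^esub> pure_tensor R M N \<zero>\<^bsub>M\<^esub> \<zero>\<^bsub>N\<^esub>)"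
      by (intro smult pure pure_tensor_closed assms) auto
    then show ?case
      by (simp add: pure_tensor_closed assms linear_maps_zero[OF mP T.module_axioms proj])
  next
    case (gen z)
    then show ?case using pure by (auto simp: pure_tensor_def)
  next
    case (add p q)
    then show ?case using assms(5) by (simp add: linear_maps_add[OF proj] linear_maps_closed[OF proj])
  next
    case (smult a p)
    then show ?case using assms(6) by (simp add: linear_maps_smult[OF proj] linear_maps_closed[OF proj])
  qed
  then show ?thesis by (simp add: p(2))
qed

text \<open>Two linear maps agree on a set closed under addition and scaling. All later identities
  between maps out of a tensor product are reduced to pure tensors by this rule.\<close>

lemma tensor_linear_maps_eqI:
  assumes "module R M" "module R N" "t \<in> carrier (tensor R M N)"
    and f: "f \<in> linear_maps R (tensor R M N) Q" and g: "g \<in> linear_maps R (tensor R M N) Q"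
    and "\<And>x y. x \<in> carrier M \<Longrightarrow> y \<in> carrier N \<Longrightarrow>
      f (pure_tensor R M N x y) = g (pure_tensor R M N x y)"
  shows "f t = g t"
  using assms(1-3)
  by (induction rule: tensor_induct)
    (simp_all add: assms(6) linear_maps_add[OF f] linear_maps_add[OF g]
      linear_maps_smult[OF f] linear_maps_smult[OF g])

section \<open>Universal property of the tensor product\<close>

lemma linear_extension_tensor_kernel:
  assumes "module R M" "module R N" "module R Q" and b: "bilinear_map R M N Q b"
    and "p \<in> tensor_kernel R M N"
  shows "linear_extension R Q (\<lambda>z. b (fst z) (snd z)) p = \<zero>\<^bsub>Q\<^esub>"
proof -
  interpret M: module R M by fact
  interpret N: module R N by fact
  interpret Q: module R Q by fact
  let ?P = "tensor_pre R M N" and ?L = "linear_extension R Q (\<lambda>z. b (fst z) (snd z))"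
  have mP: "module R ?P" by (rule module_free_module) (rule M.R.is_cring)
  interpret P: module R ?P by (rule mP)
  have b': "(\<lambda>z. b (fst z) (snd z)) \<in> carrier M \<times> carrier N \<rightarrow> carrier Q"
    using bilinear_map_closed[OF b] by auto
  note L = linear_extension_linear[OF assms(3) b']
  note gen = free_gen_closed[OF M.R.is_cring]
  note [simp] = linear_maps_minus[OF mP assms(3) L] linear_maps_add[OF L] linear_maps_smult[OF L]
    linear_extension_free_gen[OF assms(3) b']
  have [simp]: "b x y \<in> carrier Q" if "x \<in> carrier M" "y \<in> carrier N" for x y
    by (rule bilinear_map_closed[OF b that])
  note eqs = linear_maps_add[OF bilinear_map_linear1[OF b]] linear_maps_add[OF bilinear_map_linear2[OF b]]
    linear_maps_smult[OF bilinear_map_linear1[OF b]] linear_maps_smult[OF bilinear_map_linear2[OF b]]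
  have diff: "u \<ominus>\<^bsub>Q\<^esub> u = \<zero>\<^bsub>Q\<^esub>" if "u \<in> carrier Q" for u
    using that by (simp add: a_minus_def Q.r_neg)
  \<comment> \<open>Bilinearity of \<open>b\<close> sends each relation to a difference
    \<open>u - u\<close>. The kernel of the extension is a submodule, so by minimality it contains
    everything the relations generate.\<close>
  have "tensor_relations R M N \<subseteq> a_kernel ?P Q ?L"
  proof
    fix r assume r: "r \<in> tensor_relations R M N"
    then have "?L r = \<zero>\<^bsub>Q\<^esub>"
      unfolding tensor_relations_def Let_def
      by (elim UnE CollectE exE conjE) (simp_all add: gen eqs diff)
    then show "r \<in> a_kernel ?P Q ?L"
      using r tensor_relations_subset[OF assms(1,2)] by (auto simp: a_kernel_def')
  qed
  then have "tensor_kernel R M N \<subseteq> a_kernel ?P Q ?L"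
    by (intro generated_submodule_minimal submodule_kernel mP assms L)
  then show ?thesis using assms(5) by (auto simp: a_kernel_def')
qed

lemma tensor_lift_eq:
  "tensor_lift R Q b = (\<lambda>A. the_elem (linear_extension R Q (\<lambda>z. b (fst z) (snd z)) ` A))"
  by (simp add: fun_eq_iff tensor_lift_def linear_extension_def)

text \<open>The lift is the linear extension of \<open>b\<close> pushed down to the quotient; on a
  pure tensor it can be evaluated at the generator that represents it.\<close>

lemma
  assumes "module R M" "module R N" "module R Q" and b: "bilinear_map R M N Q b"
  shows tensor_lift_linear: "tensor_lift R Q b \<in> linear_maps R (tensor R M N) Q"
    and tensor_lift_pure: "\<And>x y. x \<in> carrier M \<Longrightarrow> y \<in> carrier N \<Longrightarrow>
      tensor_lift R Q b (pure_tensor R M N x y) = b x y"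
proof -
  interpret M: module R M by fact
  let ?P = "tensor_pre R M N" and ?L = "linear_extension R Q (\<lambda>z. b (fst z) (snd z))"
  have mP: "module R ?P" by (rule module_free_module) (rule M.R.is_cring)
  have b': "(\<lambda>z. b (fst z) (snd z)) \<in> carrier M \<times> carrier N \<rightarrow> carrier Q"
    using bilinear_map_closed[OF b] by auto
  note L = linear_extension_linear[OF assms(3) b']
  note K = submodule_tensor_kernel[OF assms(1,2)]
  note V = linear_extension_tensor_kernel[OF assms]
  show "tensor_lift R Q b \<in> linear_maps R (tensor R M N) Q"
    unfolding tensor_lift_eq tensor_def by (rule quotient_lift_linear[OF mP K assms(3) L V])
  show "tensor_lift R Q b (pure_tensor R M N x y) = b x y" if "x \<in> carrier M" "y \<in> carrier N" for x y
    unfolding tensor_lift_eq pure_tensor_def using that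
    by (subst quotient_lift_coset[OF mP K assms(3) L V])
      (simp_all add: free_gen_closed[OF M.R.is_cring] linear_extension_free_gen[OF assms(3) b'])
qed

section \<open>Functoriality of the tensor product\<close>

lemma bilinear_map_comp:
  assumes "bilinear_map R M' N' Q b" "f \<in> linear_maps R M M'" "g \<in> linear_maps R N N'"
  shows "bilinear_map R M N Q (\<lambda>x y. b (f x) (g y))"
  unfolding bilinear_map_def
proof (intro conjI ballI)
  fix x assume "x \<in> carrier M"
  then show "(\<lambda>y. b (f x) (g y)) \<in> linear_maps R N Q"
    by (intro linear_maps_comp[OF assms(3)] bilinear_map_linear2[OF assms(1)] linear_maps_closed[OF assms(2)])
next
  fix y assume "y \<in> carrier N"
  then show "(\<lambda>x. b (f x) (g y)) \<in> linear_maps R M Q"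
    by (intro linear_maps_comp[OF assms(2), where g = "\<lambda>x. b x (g y)"] bilinear_map_linear1[OF assms(1)]
        linear_maps_closed[OF assms(3)])
qed

context
  fixes R :: "('r, 'e) ring_scheme" and M :: "('r, 'a, 'c) module_scheme"
    and N :: "('r, 'b, 'd) module_scheme" and M' :: "('r, 'a2, 'c2) module_scheme"
    and N' :: "('r, 'b2, 'd2) module_scheme"
  assumes modules: "module R M" "module R N" "module R M'" "module R N'"
begin

lemma tensor_map_linear:
  assumes "f \<in> linear_maps R M M'" "g \<in> linear_maps R N N'"
  shows "tensor_map R M' N' f g \<in> linear_maps R (tensor R M N) (tensor R M' N')"
  unfolding tensor_map_def
  by (intro tensor_lift_linear bilinear_map_comp[OF pure_tensor_bilinear] module_tensor modules assms)

lemma tensor_map_pure: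
  assumes "f \<in> linear_maps R M M'" "g \<in> linear_maps R N N'" "x \<in> carrier M" "y \<in> carrier N"
  shows "tensor_map R M' N' f g (pure_tensor R M N x y) = pure_tensor R M' N' (f x) (g y)"
  unfolding tensor_map_def
  by (rule tensor_lift_pure)
    (intro bilinear_map_comp[OF pure_tensor_bilinear] module_tensor modules assms)+

end

text \<open>The composites enter as arbitrary \<open>h\<close> and \<open>k\<close> that agree with
  them on the carriers. This accommodates composites known only there, and also lets
  \<open>id\<close> be absorbed on either side.\<close>

lemma tensor_map_comp:
  assumes "module R M" "module R N" "module R M'" "module R N'" "module R M''" "module R N''"
    and f: "f \<in> linear_maps R M M'" and g: "g \<in> linear_maps R N N'"
    and f': "f' \<in> linear_maps R M' M''" and g': "g' \<in> linear_maps R N' N''"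
    and h: "h \<in> linear_maps R M M''" and k: "k \<in> linear_maps R N N''"
    and "\<And>x. x \<in> carrier M \<Longrightarrow> f' (f x) = h x" "\<And>y. y \<in> carrier N \<Longrightarrow> g' (g y) = k y"
    and "t \<in> carrier (tensor R M N)"
  shows "tensor_map R M'' N'' f' g' (tensor_map R M' N' f g t) = tensor_map R M'' N'' h k t"
proof (rule tensor_linear_maps_eqI[OF assms(1,2,15)])
  show "(\<lambda>t. tensor_map R M'' N'' f' g' (tensor_map R M' N' f g t))
      \<in> linear_maps R (tensor R M N) (tensor R M'' N'')"
    by (rule linear_maps_comp[OF tensor_map_linear tensor_map_linear]) (intro assms)+
  show "tensor_map R M'' N'' h k \<in> linear_maps R (tensor R M N) (tensor R M'' N'')"
    by (intro tensor_map_linear assms)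
qed (simp add: assms tensor_map_pure[of R M N M' N' f g] tensor_map_pure[of R M' N' M'' N'' f' g']
    tensor_map_pure[of R M N M'' N'' h k] linear_maps_closed[OF f] linear_maps_closed[OF g])

text \<open>A commuting square in each factor gives a commuting square of tensor products: both ways
  round equal the tensor product of the two diagonals.\<close>

lemma tensor_map_square:
  assumes t: "t \<in> carrier (tensor R M N)"
    and "module R M" "module R N" "module R M1" "module R N1" "module R M2" "module R N2"
      "module R M'" "module R N'"
    and "f1 \<in> linear_maps R M M1" "g1 \<in> linear_maps R N N1"
    and "f2 \<in> linear_maps R M1 M'" "g2 \<in> linear_maps R N1 N'"
    and "h1 \<in> linear_maps R M M2" "k1 \<in> linear_maps R N N2"
    and "h2 \<in> linear_maps R M2 M'" "k2 \<in> linear_maps R N2 N'"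
    and "\<And>x. x \<in> carrier M \<Longrightarrow> f2 (f1 x) = h2 (h1 x)" "\<And>y. y \<in> carrier N \<Longrightarrow> g2 (g1 y) = k2 (k1 y)"
  shows "tensor_map R M' N' f2 g2 (tensor_map R M1 N1 f1 g1 t)
    = tensor_map R M' N' h2 k2 (tensor_map R M2 N2 h1 k1 t)"
proof -
  note hk = linear_maps_comp[OF assms(14,16)] linear_maps_comp[OF assms(15,17)]
  have "tensor_map R M' N' f2 g2 (tensor_map R M1 N1 f1 g1 t)
      = tensor_map R M' N' (\<lambda>x. h2 (h1 x)) (\<lambda>y. k2 (k1 y)) t"
    by (rule tensor_map_comp[OF assms(2-5,8,9,10-13) hk assms(18,19) t])
  also have "\<dots> = tensor_map R M' N' h2 k2 (tensor_map R M2 N2 h1 k1 t)"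
    by (rule tensor_map_comp[OF assms(2,3,6-9,14-17) hk refl refl t, symmetric])
  finally show ?thesis .
qed

lemma tensor_map_id:
  assumes "module R M" "module R N"
    and f: "f \<in> linear_maps R M M" and g: "g \<in> linear_maps R N N"
    and "\<And>x. x \<in> carrier M \<Longrightarrow> f x = x" "\<And>y. y \<in> carrier N \<Longrightarrow> g y = y"
    and "t \<in> carrier (tensor R M N)"
  shows "tensor_map R M N f g t = t"
proof -
  have "tensor_map R M N f g t = id t"
    by (rule tensor_linear_maps_eqI[OF assms(1,2,7) tensor_map_linear linear_maps_id])
      (simp_all add: assms tensor_map_pure)
  then show ?thesis by simp
qed

text \<open>Additivity in the left factor turns an identity such as f - f' = d \<Psi> + \<Psi> d
  into the corresponding identity after tensoring.\<close>

lemma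
  assumes "module R M" "module R N" "module R M'" "module R N'"
    and f: "f \<in> linear_maps R M M'" and f': "f' \<in> linear_maps R M M'" and g: "g \<in> linear_maps R N N'"
    and h: "h \<in> linear_maps R M M'" and t: "t \<in> carrier (tensor R M N)"
  shows tensor_map_sum_left: "(\<And>x. x \<in> carrier M \<Longrightarrow> h x = f x \<oplus>\<^bsub>M'\<^esub> f' x) \<Longrightarrow>
      tensor_map R M' N' h g t = tensor_map R M' N' f g t \<oplus>\<^bsub>tensor R M' N'\<^esub> tensor_map R M' N' f' g t"
    and tensor_map_diff_left: "(\<And>x. x \<in> carrier M \<Longrightarrow> h x = f x \<ominus>\<^bsub>M'\<^esub> f' x) \<Longrightarrow>
      tensor_map R M' N' h g t = tensor_map R M' N' f g t \<ominus>\<^bsub>tensor R M' N'\<^esub> tensor_map R M' N' f' g t"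
proof -
  note T = module_tensor[OF assms(3,4)]
  note lin = tensor_map_linear[OF assms(1-4) _ g]
  note pure = tensor_map_pure[OF assms(1-4) _ g]
  note b = bilinear_map_linear1[OF pure_tensor_bilinear[OF assms(3,4)]]
  note [simp] = linear_maps_closed[OF f] linear_maps_closed[OF f'] linear_maps_closed[OF g]
  show "tensor_map R M' N' h g t = tensor_map R M' N' f g t \<oplus>\<^bsub>tensor R M' N'\<^esub> tensor_map R M' N' f' g t"
    if "\<And>x. x \<in> carrier M \<Longrightarrow> h x = f x \<oplus>\<^bsub>M'\<^esub> f' x"
    by (rule tensor_linear_maps_eqI[OF assms(1,2) t lin[OF h]
          linear_maps_sum[OF T lin[OF f] lin[OF f']]])
      (simp add: pure h f f' that linear_maps_add[OF b])
  show "tensor_map R M' N' h g t = tensor_map R M' N' f g t \<ominus>\<^bsub>tensor R M' N'\<^esub> tensor_map R M' N' f' g t"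
    if "\<And>x. x \<in> carrier M \<Longrightarrow> h x = f x \<ominus>\<^bsub>M'\<^esub> f' x"
    by (rule tensor_linear_maps_eqI[OF assms(1,2) t lin[OF h]
          linear_maps_diff[OF T lin[OF f] lin[OF f']]])
      (simp add: pure h f f' that linear_maps_minus[OF assms(3) T b])
qed

section \<open>Direct sums\<close>

lemma direct_sum_simps:
  "x \<in> carrier (direct_sum M) \<longleftrightarrow> (\<forall>i. x i \<in> carrier (M i)) \<and> finite {i. x i \<noteq> \<zero>\<^bsub>M i\<^esub>}"
  "\<zero>\<^bsub>direct_sum M\<^esub> = (\<lambda>i. \<zero>\<^bsub>M i\<^esub>)"
  "x \<oplus>\<^bsub>direct_sum M\<^esub> y = (\<lambda>i. x i \<oplus>\<^bsub>M i\<^esub> y i)"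
  "a \<odot>\<^bsub>direct_sum M\<^esub> x = (\<lambda>i. a \<odot>\<^bsub>M i\<^esub> x i)"
  by (simp_all add: direct_sum_def)

text \<open>Finite support survives because the preimage of a finite set under the injective
  reindexing \<open>h\<close> is finite. The reindexings that occur are the identity for chain maps,
  \<open>k + 1\<close> for homotopies and \<open>n - k\<close> for the braiding.\<close>

lemma direct_sum_map_closed:
  assumes "inj h" "\<And>i. module R (M i)" "\<And>i. module R (N i)"
    and f: "\<And>i. f i \<in> linear_maps R (M (h i)) (N i)"
    and x: "x \<in> carrier (direct_sum M)"
  shows "(\<lambda>i. f i (x (h i))) \<in> carrier (direct_sum N)"
proof -
  have "{i. f i (x (h i)) \<noteq> \<zero>\<^bsub>N i\<^esub>} \<subseteq> h -` {i. x i \<noteq> \<zero>\<^bsub>M i\<^esub>}"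
    using linear_maps_zero[OF assms(2,3) f] by auto
  moreover have "finite (h -` {i. x i \<noteq> \<zero>\<^bsub>M i\<^esub>})"
    using x by (intro finite_vimageI[OF _ assms(1)]) (simp add: direct_sum_simps)
  ultimately show ?thesis
    using x linear_maps_closed[OF f] finite_subset by (auto simp: direct_sum_simps)
qed

lemma direct_sum_map_linear:
  assumes "inj h" "\<And>i. module R (M i)" "\<And>i. module R (N i)"
    and f: "\<And>i. f i \<in> linear_maps R (M (h i)) (N i)"
  shows "(\<lambda>x i. f i (x (h i))) \<in> linear_maps R (direct_sum M) (direct_sum N)"
proof (rule linear_mapsI)
  fix x assume "x \<in> carrier (direct_sum M)"
  then show "(\<lambda>i. f i (x (h i))) \<in> carrier (direct_sum N)"
    by (intro direct_sum_map_closed[where h = h and R = R and M = M and N = N] assms)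
qed (auto simp: direct_sum_simps linear_maps_add[OF f] linear_maps_smult[OF f])

lemma module_direct_sum:
  assumes "\<And>i. module R (M i)"
  shows "module R (direct_sum M)"
proof -
  interpret M: module R "M i" for i by (rule assms)
  have add: "x \<oplus>\<^bsub>direct_sum M\<^esub> y \<in> carrier (direct_sum M)"
    if "x \<in> carrier (direct_sum M)" "y \<in> carrier (direct_sum M)" for x y
  proof -
    have "{i. x i \<oplus>\<^bsub>M i\<^esub> y i \<noteq> \<zero>\<^bsub>M i\<^esub>} \<subseteq> {i. x i \<noteq> \<zero>\<^bsub>M i\<^esub>} \<union> {i. y i \<noteq> \<zero>\<^bsub>M i\<^esub>}"
      using M.l_zero[OF M.zero_closed] by auto
    then show ?thesis
      using that finite_subset by (auto simp: direct_sum_simps)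
  qed
  \<comment> \<open>Scaling by \<open>a\<close> is itself a linear map in each component, by
    commutativity of \<open>R\<close>, so finite support follows from the reindexing lemma.\<close>
  have smult: "a \<odot>\<^bsub>direct_sum M\<^esub> x \<in> carrier (direct_sum M)"
    if "a \<in> carrier R" "x \<in> carrier (direct_sum M)" for a x
    unfolding direct_sum_simps(4) using that(1)
    by (intro direct_sum_map_closed[where h = "\<lambda>i. i", OF _ assms assms _ that(2)] linear_mapsI)
      (auto simp: M.smult_r_distr M.smult_assoc1[symmetric] M.R.m_comm)
  have neg: "(\<lambda>i. \<ominus>\<^bsub>M i\<^esub> x i) \<in> carrier (direct_sum M)" if "x \<in> carrier (direct_sum M)" for x
    using linear_maps_uminus[OF assms linear_maps_id]
    by (intro direct_sum_map_closed[where h = "\<lambda>i. i", OF _ assms assms _ that]) auto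
  show ?thesis
  proof (rule moduleI)
    show "abelian_group (direct_sum M)"
    proof (rule abelian_groupI)
      fix x assume "x \<in> carrier (direct_sum M)"
      then show "\<exists>y\<in>carrier (direct_sum M). y \<oplus>\<^bsub>direct_sum M\<^esub> x = \<zero>\<^bsub>direct_sum M\<^esub>"
        using neg by (intro bexI[where x = "\<lambda>i. \<ominus>\<^bsub>M i\<^esub> x i"]) (auto simp: direct_sum_simps M.l_neg)
    qed (use add in \<open>auto simp: direct_sum_simps M.a_ac\<close>)
  qed (use smult in \<open>auto simp: direct_sum_simps M.R.is_cring M.smult_l_distr M.smult_r_distr M.smult_assoc1\<close>)
qed

text \<open>Negation in the direct sum is characterised only by the group axioms, so its components
  are identified through uniqueness of additive inverses.\<close>

lemma direct_sum_minus:
  assumes "\<And>i. module R (M i)" "x \<in> carrier (direct_sum M)" "y \<in> carrier (direct_sum M)"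
  shows "x \<ominus>\<^bsub>direct_sum M\<^esub> y = (\<lambda>i. x i \<ominus>\<^bsub>M i\<^esub> y i)"
proof -
  interpret M: module R "M i" for i by (rule assms)
  interpret S: module R "direct_sum M" by (rule module_direct_sum) (rule assms)
  have "(\<ominus>\<^bsub>direct_sum M\<^esub> y) i = \<ominus>\<^bsub>M i\<^esub> y i" for i
  proof (rule M.minus_equality[symmetric])
    have "(\<ominus>\<^bsub>direct_sum M\<^esub> y \<oplus>\<^bsub>direct_sum M\<^esub> y) i = \<zero>\<^bsub>M i\<^esub>"
      using S.l_neg[OF assms(3)] by (simp add: direct_sum_simps)
    then show "(\<ominus>\<^bsub>direct_sum M\<^esub> y) i \<oplus>\<^bsub>M i\<^esub> y i = \<zero>\<^bsub>M i\<^esub>"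
      by (simp add: direct_sum_simps)
  qed (use assms(3) S.a_inv_closed[OF assms(3)] in \<open>simp_all add: direct_sum_simps\<close>)
  then show ?thesis by (simp add: a_minus_def direct_sum_simps)
qed

section \<open>Signs\<close>

lemma neg_one_pow_closed:
  assumes "module R M" "x \<in> carrier M"
  shows "neg_one_pow M k x \<in> carrier M"
proof -
  interpret M: module R M by fact
  show ?thesis using assms(2) by (simp add: neg_one_pow_def)
qed

lemma linear_maps_neg_one_pow:
  assumes "module R M" "module R N" "f \<in> linear_maps R M N" "x \<in> carrier M"
  shows "f (neg_one_pow M k x) = neg_one_pow N k (f x)"
  using assms by (simp add: neg_one_pow_def linear_maps_a_inv)

lemma neg_one_pow_linear:
  assumes "module R M" shows "neg_one_pow M k \<in> linear_maps R M M"
  using linear_maps_id[of R M] linear_maps_uminus[OF assms linear_maps_id]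
  by (cases "even k") (simp_all add: neg_one_pow_def[abs_def] id_def)

lemma neg_one_pow_neg_one_pow:
  assumes "module R M" "x \<in> carrier M"
  shows "neg_one_pow M j (neg_one_pow M k x) = neg_one_pow M (j + k) x"
proof -
  interpret M: module R M by fact
  show ?thesis using assms(2) by (auto simp: neg_one_pow_def)
qed

text \<open>Sign identities thereby become parity statements about exponents.\<close>

lemma neg_one_pow_cong: "even j \<longleftrightarrow> even k \<Longrightarrow> neg_one_pow M j x = neg_one_pow M k x"
  by (simp add: neg_one_pow_def)

section \<open>Tensor products of complexes\<close>

lemma chain_complex_module: "chain_complex R X \<Longrightarrow> module R (Obj X n)"
  by (simp add: chain_complex_def)

lemma chain_complex_Dif: "chain_complex R X \<Longrightarrow> Dif X n \<in> linear_maps R (Obj X n) (Obj X (n + 1))"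
  by (simp add: chain_complex_def)

text \<open>The target index \<open>n - 1 + 1\<close> is replaced by \<open>n\<close>, so that this
  differential can be composed with maps out of degree \<open>n\<close>.\<close>

lemma chain_complex_Dif':
  "chain_complex R X \<Longrightarrow> Dif X (n - 1) \<in> linear_maps R (Obj X (n - 1)) (Obj X n)"
  using chain_complex_Dif[of R X "n - 1"] by simp

lemma chain_map_linear: "chain_map R X Y f \<Longrightarrow> f n \<in> linear_maps R (Obj X n) (Obj Y n)"
  by (simp add: chain_map_def)

lemma chain_map_Dif:
  "chain_map R X Y f \<Longrightarrow> x \<in> carrier (Obj X n) \<Longrightarrow> f (n + 1) (Dif X n x) = Dif Y n (f n x)"
  by (simp add: chain_map_def)

lemma chain_map_Dif':
  "chain_map R X Y f \<Longrightarrow> x \<in> carrier (Obj X (n - 1)) \<Longrightarrow> f n (Dif X (n - 1) x) = Dif Y (n - 1) (f (n - 1) x)"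
  using chain_map_Dif[of R X Y f x "n - 1"] by simp

lemma chain_map_id: "chain_map R X X (\<lambda>n. id)"
  by (simp add: chain_map_def linear_maps_id)

lemma tensor_complex_simps:
  "Obj (tensor_complex R X Y) n = direct_sum (\<lambda>i. tensor R (Obj X i) (Obj Y (n - i)))"
  "Dif (tensor_complex R X Y) n t k =
      tensor_map R (Obj X k) (Obj Y (n + 1 - k)) (Dif X (k - 1)) id (t (k - 1))
      \<oplus>\<^bsub>tensor R (Obj X k) (Obj Y (n + 1 - k))\<^esub>
      neg_one_pow (tensor R (Obj X k) (Obj Y (n + 1 - k))) k
        (tensor_map R (Obj X k) (Obj Y (n + 1 - k)) id (Dif Y (n - k)) (t k))"
  by (simp_all add: tensor_complex_def Let_def)

text \<open>The degree of the second factor is a separate variable with an equation, so that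
  whichever form of the index is in use can be matched.\<close>

lemma tensor_complex_component:
  "t \<in> carrier (Obj (tensor_complex R X Y) n) \<Longrightarrow> n - k = j \<Longrightarrow> t k \<in> carrier (tensor R (Obj X k) (Obj Y j))"
  by (auto simp: tensor_complex_simps direct_sum_simps)

section \<open>Tensoring chain maps and homotopies\<close>

lemma tensor_chain_map_linear:
  assumes "chain_complex R X" "chain_complex R Y" "chain_complex R X'" "chain_complex R Y'"
    and "chain_map R X X' f" "chain_map R Y Y' g"
  shows "tensor_chain_map R X' Y' f g n
    \<in> linear_maps R (Obj (tensor_complex R X Y) n) (Obj (tensor_complex R X' Y') n)"
  unfolding tensor_complex_simps tensor_chain_map_def[abs_def]
  by (rule direct_sum_map_linear[where h = "\<lambda>i. i"])
    (auto intro!: module_tensor tensor_map_linear chain_complex_module chain_map_linear assms)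

text \<open>Each of the two summands of the differential commutes by a tensor square, the first
  using that \<open>f\<close> is a chain map and the second that \<open>g\<close> is. The sign
  depends on the degree alone and passes through linear maps.\<close>

lemma tensor_chain_map_chain_map:
  assumes X: "chain_complex R X" and Y: "chain_complex R Y"
    and X': "chain_complex R X'" and Y': "chain_complex R Y'"
    and f: "chain_map R X X' f" and g: "chain_map R Y Y' g"
  shows "chain_map R (tensor_complex R X Y) (tensor_complex R X' Y') (tensor_chain_map R X' Y' f g)"
  unfolding chain_map_def
proof (intro conjI allI ballI)
  fix n show "tensor_chain_map R X' Y' f g n
      \<in> linear_maps R (Obj (tensor_complex R X Y) n) (Obj (tensor_complex R X' Y') n)"
    by (rule tensor_chain_map_linear) fact+
next
  fix n t assume t: "t \<in> carrier (Obj (tensor_complex R X Y) n)"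
  note lin = chain_map_linear[OF f] chain_map_linear[OF g] chain_complex_Dif[OF X]
    chain_complex_Dif[OF Y] chain_complex_Dif[OF X'] chain_complex_Dif[OF Y']
    chain_complex_Dif'[OF X] chain_complex_Dif'[OF X'] linear_maps_id
  note mods = chain_complex_module[OF X] chain_complex_module[OF Y]
    chain_complex_module[OF X'] chain_complex_module[OF Y']
  show "tensor_chain_map R X' Y' f g (n + 1) (Dif (tensor_complex R X Y) n t)
      = Dif (tensor_complex R X' Y') n (tensor_chain_map R X' Y' f g n t)"
  proof
    fix k
    \<comment> \<open>Both summands have to live in literally the same module, so the degree of the
      second factor is brought to the form \<open>n - k + 1\<close>.\<close>
    have ix: "n + 1 - k = n - k + 1" "n - (k - 1) = n - k + 1" by simp_all
    let ?T = "tensor R (Obj X k) (Obj Y (n - k + 1))" and ?T' = "tensor R (Obj X' k) (Obj Y' (n - k + 1))"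
    let ?F = "tensor_map R (Obj X' k) (Obj Y' (n - k + 1)) (f k) (g (n - k + 1))"
    have t1: "t (k - 1) \<in> carrier (tensor R (Obj X (k - 1)) (Obj Y (n - k + 1)))"
      and t2: "t k \<in> carrier (tensor R (Obj X k) (Obj Y (n - k)))"
      using t by (auto intro!: tensor_complex_component)
    let ?u = "tensor_map R (Obj X k) (Obj Y (n - k + 1)) (Dif X (k - 1)) id (t (k - 1))"
    let ?v = "tensor_map R (Obj X k) (Obj Y (n - k + 1)) id (Dif Y (n - k)) (t k)"
    have u: "?u \<in> carrier ?T" and v: "?v \<in> carrier ?T"
      by (rule linear_maps_closed[OF tensor_map_linear t1] linear_maps_closed[OF tensor_map_linear t2];
          intro mods lin)+
    have F: "?F \<in> linear_maps R ?T ?T'" by (intro tensor_map_linear mods lin)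
    have T: "module R ?T" "module R ?T'" by (intro module_tensor mods)+
    have "?F (?u \<oplus>\<^bsub>?T\<^esub> neg_one_pow ?T k ?v) = ?F ?u \<oplus>\<^bsub>?T'\<^esub> neg_one_pow ?T' k (?F ?v)"
      by (simp add: linear_maps_add[OF F] u v neg_one_pow_closed[OF T(1)] linear_maps_neg_one_pow[OF T F])
    also have "?F ?u = tensor_map R (Obj X' k) (Obj Y' (n - k + 1)) (Dif X' (k - 1)) id
        (tensor_map R (Obj X' (k - 1)) (Obj Y' (n - k + 1)) (f (k - 1)) (g (n - k + 1)) (t (k - 1)))"
      by (rule tensor_map_square[OF t1]) (intro mods lin | simp add: chain_map_Dif'[OF f])+
    also have "?F ?v = tensor_map R (Obj X' k) (Obj Y' (n - k + 1)) id (Dif Y' (n - k))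
        (tensor_map R (Obj X' k) (Obj Y' (n - k)) (f k) (g (n - k)) (t k))"
      by (rule tensor_map_square[OF t2]) (intro mods lin | simp add: chain_map_Dif[OF g])+
    finally show "tensor_chain_map R X' Y' f g (n + 1) (Dif (tensor_complex R X Y) n t) k
      = Dif (tensor_complex R X' Y') n (tensor_chain_map R X' Y' f g n t) k"
      by (simp only: tensor_chain_map_def tensor_complex_simps ix)
  qed
qed

text \<open>The homotopy is \<Psi> \<otimes> id. In d \<Theta> + \<Theta> d the mixed term \<Psi>
  \<otimes> d occurs twice, and it cancels because \<Psi> lowers the left degree by one and thus
  flips the sign in front of d. What remains is (d \<Psi> + \<Psi> d) \<otimes> id.\<close>

lemma chain_homotopic_tensor:
  assumes X: "chain_complex R X" and X': "chain_complex R X'" and Y: "chain_complex R Y"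
    and f: "chain_map R X X' f" and f': "chain_map R X X' f'"
    and "chain_homotopic R X X' f f'"
  shows "chain_homotopic R (tensor_complex R X Y) (tensor_complex R X' Y)
    (tensor_chain_map R X' Y f (\<lambda>n. id)) (tensor_chain_map R X' Y f' (\<lambda>n. id))"
proof -
  obtain \<Psi> where \<Psi>: "\<And>i. \<Psi> i \<in> linear_maps R (Obj X i) (Obj X' (i - 1))"
    and h: "\<And>i x. x \<in> carrier (Obj X i) \<Longrightarrow>
      f i x \<ominus>\<^bsub>Obj X' i\<^esub> f' i x = Dif X' (i - 1) (\<Psi> i x) \<oplus>\<^bsub>Obj X' i\<^esub> \<Psi> (i + 1) (Dif X i x)"
    using assms(6) unfolding chain_homotopic_def by blast
  have \<Psi>': "\<Psi> (i + 1) \<in> linear_maps R (Obj X (i + 1)) (Obj X' i)" for i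
    using \<Psi>[of "i + 1"] by simp
  \<comment> \<open>Component \<open>k\<close> of the output comes from component
    \<open>k + 1\<close> of the input, since \<open>\<Psi> (k + 1)\<close> lands in degree
    \<open>k\<close>; the second factor keeps its degree because
    \<open>n - 1 - k = n - (k + 1)\<close>.\<close>
  define \<Theta> where "\<Theta> n t k = tensor_map R (Obj X' k) (Obj Y (n - 1 - k)) (\<Psi> (k + 1)) id (t (k + 1))"
    for n t k
  note lin = chain_map_linear[OF f] chain_map_linear[OF f'] chain_complex_Dif[OF X]
    chain_complex_Dif[OF X'] chain_complex_Dif'[OF X'] chain_complex_Dif[OF Y] chain_complex_Dif'[OF Y]
    linear_maps_id \<Psi> \<Psi>'
  note mods = chain_complex_module[OF X] chain_complex_module[OF X'] chain_complex_module[OF Y]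
  have \<Theta>_linear: "\<Theta> n \<in> linear_maps R (Obj (tensor_complex R X Y) n) (Obj (tensor_complex R X' Y) (n - 1))"
    for n
    unfolding tensor_complex_simps \<Theta>_def[abs_def]
  proof (rule direct_sum_map_linear[where h = "\<lambda>k. k + 1"])
    fix k
    have "n - (k + 1) = n - 1 - k" by simp
    then show "tensor_map R (Obj X' k) (Obj Y (n - 1 - k)) (\<Psi> (k + 1)) id
        \<in> linear_maps R (tensor R (Obj X (k + 1)) (Obj Y (n - (k + 1))))
            (tensor R (Obj X' k) (Obj Y (n - 1 - k)))"
      by (simp only:) (intro tensor_map_linear mods lin)
  qed (auto intro!: module_tensor mods)
  have "tensor_chain_map R X' Y f (\<lambda>n. id) n t
        \<ominus>\<^bsub>Obj (tensor_complex R X' Y) n\<^esub> tensor_chain_map R X' Y f' (\<lambda>n. id) n t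
      = Dif (tensor_complex R X' Y) (n - 1) (\<Theta> n t)
        \<oplus>\<^bsub>Obj (tensor_complex R X' Y) n\<^esub> \<Theta> (n + 1) (Dif (tensor_complex R X Y) n t)"
    (is "?l = ?r") if t: "t \<in> carrier (Obj (tensor_complex R X Y) n)" for n t
  proof
    fix k
    let ?T = "tensor R (Obj X' k) (Obj Y (n - k))"
    let ?S = "tensor R (Obj X (k + 1)) (Obj Y (n - k))"
    let ?map = "tensor_map R (Obj X' k) (Obj Y (n - k))"
    let ?map1 = "tensor_map R (Obj X (k + 1)) (Obj Y (n - k))"
    let ?A = "?map (\<lambda>x. Dif X' (k - 1) (\<Psi> k x)) id (t k)"
    let ?B = "?map (\<Psi> (k + 1)) (Dif Y (n - 1 - k)) (t (k + 1))"
    let ?C = "?map (\<lambda>x. \<Psi> (k + 1) (Dif X k x)) id (t k)"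
    have ix: "n - 1 + 1 - k = n - k" "k - 1 + 1 = k" "n - 1 - (k - 1) = n - k" "n + 1 - 1 - k = n - k"
      "n + 1 - (k + 1) = n - k" "k + 1 - 1 = k" "n - (k + 1) = n - 1 - k" by simp_all
    have T: "module R ?T" and S: "module R ?S" by (intro module_tensor mods)+
    interpret T: module R ?T by (rule T)
    have t1: "t (k + 1) \<in> carrier (tensor R (Obj X (k + 1)) (Obj Y (n - 1 - k)))"
      and t2: "t k \<in> carrier (tensor R (Obj X k) (Obj Y (n - k)))"
      using t by (auto intro!: tensor_complex_component)
    have dY: "Dif Y (n - 1 - k) \<in> linear_maps R (Obj Y (n - 1 - k)) (Obj Y (n - k))"
      using chain_complex_Dif[OF Y, of "n - 1 - k"] by (simp add: algebra_simps)
    note \<Psi>d = linear_maps_comp[OF chain_complex_Dif[OF X, of k] \<Psi>'[of k]]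
    note d\<Psi> = linear_maps_comp[OF \<Psi>[of k] chain_complex_Dif'[OF X']]
    have A: "?A \<in> carrier ?T" and B: "?B \<in> carrier ?T" and C: "?C \<in> carrier ?T"
      by (rule linear_maps_closed[OF tensor_map_linear t1] linear_maps_closed[OF tensor_map_linear t2];
          intro mods lin d\<Psi> \<Psi>d dY)+
    have "?l k = ?map (f k) id (t k) \<ominus>\<^bsub>?T\<^esub> ?map (f' k) id (t k)"
      using linear_maps_closed[OF tensor_chain_map_linear[OF X Y X' Y f chain_map_id] t]
        linear_maps_closed[OF tensor_chain_map_linear[OF X Y X' Y f' chain_map_id] t]
      unfolding tensor_complex_simps
      by (subst direct_sum_minus[where R = R]) (simp_all add: module_tensor mods tensor_chain_map_def)
    also have "\<dots> = ?map (\<lambda>x. f k x \<ominus>\<^bsub>Obj X' k\<^esub> f' k x) id (t k)"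
      by (rule tensor_map_diff_left[symmetric, where M = "Obj X k" and N = "Obj Y (n - k)"])
        (intro mods lin t2 refl linear_maps_diff)+
    also have "\<dots> = ?A \<oplus>\<^bsub>?T\<^esub> ?C"
      by (rule tensor_map_sum_left[where M = "Obj X k" and N = "Obj Y (n - k)"])
        (intro mods lin t2 linear_maps_diff d\<Psi> \<Psi>d h | assumption)+
    \<comment> \<open>The mixed term \<open>?B\<close> is inserted with both signs: exponent
      \<open>k\<close> belongs to the differential applied after \<Theta>, exponent
      \<open>k + 1\<close> to the one applied before it.\<close>
    also have "\<dots> = (?A \<oplus>\<^bsub>?T\<^esub> neg_one_pow ?T k ?B) \<oplus>\<^bsub>?T\<^esub> (?C \<oplus>\<^bsub>?T\<^esub> neg_one_pow ?T (k + 1) ?B)"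
      using A B C by (auto simp: neg_one_pow_def T.a_ac T.r_neg T.r_neg1 T.r_neg2)
    also have "?A \<oplus>\<^bsub>?T\<^esub> neg_one_pow ?T k ?B = Dif (tensor_complex R X' Y) (n - 1) (\<Theta> n t) k"
    proof -
      have "?A = ?map (Dif X' (k - 1)) id
          (tensor_map R (Obj X' (k - 1)) (Obj Y (n - k)) (\<Psi> k) id (t k))"
        by (rule tensor_map_comp[symmetric, OF _ _ _ _ _ _ _ _ _ _ _ _ _ _ t2])
          (intro mods lin d\<Psi> refl | simp)+
      moreover have "?B = ?map id (Dif Y (n - 1 - k))
          (tensor_map R (Obj X' k) (Obj Y (n - 1 - k)) (\<Psi> (k + 1)) id (t (k + 1)))"
        by (rule tensor_map_comp[symmetric, OF _ _ _ _ _ _ _ _ _ _ _ _ _ _ t1])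
          (intro mods lin dY refl | simp)+
      ultimately show ?thesis
        by (simp only: tensor_complex_simps \<Theta>_def ix)
    qed
    also have "?C \<oplus>\<^bsub>?T\<^esub> neg_one_pow ?T (k + 1) ?B = \<Theta> (n + 1) (Dif (tensor_complex R X Y) n t) k"
    proof -
      have P: "?map (\<Psi> (k + 1)) id \<in> linear_maps R ?S ?T"
        by (intro tensor_map_linear mods lin)
      have u: "?map1 (Dif X k) id (t k) \<in> carrier ?S"
        and v: "?map1 id (Dif Y (n - 1 - k)) (t (k + 1)) \<in> carrier ?S"
        by (rule linear_maps_closed[OF tensor_map_linear t1] linear_maps_closed[OF tensor_map_linear t2];
          intro mods lin dY)+
      have "?C = ?map (\<Psi> (k + 1)) id (?map1 (Dif X k) id (t k))"
        by (rule tensor_map_comp[symmetric, OF _ _ _ _ _ _ _ _ _ _ _ _ _ _ t2])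
          (intro mods lin \<Psi>d refl | simp)+
      moreover have "?B = ?map (\<Psi> (k + 1)) id (?map1 id (Dif Y (n - 1 - k)) (t (k + 1)))"
        by (rule tensor_map_comp[symmetric, OF _ _ _ _ _ _ _ _ _ _ _ _ _ _ t1])
          (intro mods lin dY refl | simp)+
      ultimately have "?C \<oplus>\<^bsub>?T\<^esub> neg_one_pow ?T (k + 1) ?B = ?map (\<Psi> (k + 1)) id
          (?map1 (Dif X k) id (t k) \<oplus>\<^bsub>?S\<^esub>
           neg_one_pow ?S (k + 1) (?map1 id (Dif Y (n - 1 - k)) (t (k + 1))))"
        by (simp add: linear_maps_add[OF P] u v neg_one_pow_closed[OF S] linear_maps_neg_one_pow[OF S T P])
      then show ?thesis
        by (simp only: tensor_complex_simps \<Theta>_def ix)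
    qed
    finally show "?l k = ?r k"
      by (simp only: tensor_complex_simps direct_sum_simps)
  qed
  then show ?thesis
    unfolding chain_homotopic_def using \<Theta>_linear by blast
qed

text \<open>Tensoring respects composites and identities on carriers only; this rule allows passing
  to the literal composite and to \<open>id\<close>.\<close>

lemma chain_homotopic_cong:
  assumes "chain_homotopic R X Y f g"
    and "\<And>n x. x \<in> carrier (Obj X n) \<Longrightarrow> f n x = f' n x"
    and "\<And>n x. x \<in> carrier (Obj X n) \<Longrightarrow> g n x = g' n x"
  shows "chain_homotopic R X Y f' g'"
  using assms unfolding chain_homotopic_def by auto

lemma chain_map_comp:
  "chain_map R X Y f \<Longrightarrow> chain_map R Y Z g \<Longrightarrow> chain_map R X Z (\<lambda>n. g n \<circ> f n)"
  unfolding chain_map_def comp_def using linear_maps_comp linear_maps_closed by fastforce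

lemma tensor_chain_map_comp_left:
  assumes "chain_complex R X" "chain_complex R Y" "chain_complex R Z" "chain_complex R V"
    and f: "chain_map R X Y f" and g: "chain_map R Y Z g"
    and t: "t \<in> carrier (Obj (tensor_complex R X V) n)"
  shows "tensor_chain_map R Z V (\<lambda>n. g n \<circ> f n) (\<lambda>n. id) n t
    = tensor_chain_map R Z V g (\<lambda>n. id) n (tensor_chain_map R Y V f (\<lambda>n. id) n t)"
proof
  fix k
  show "tensor_chain_map R Z V (\<lambda>n. g n \<circ> f n) (\<lambda>n. id) n t k
    = tensor_chain_map R Z V g (\<lambda>n. id) n (tensor_chain_map R Y V f (\<lambda>n. id) n t) k"
    unfolding tensor_chain_map_def
    by (rule tensor_map_comp[symmetric, OF _ _ _ _ _ _ _ _ _ _ _ _ _ _ tensor_complex_component[OF t refl]])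
      (intro chain_complex_module[OF assms(1)] chain_complex_module[OF assms(2)]
        chain_complex_module[OF assms(3)] chain_complex_module[OF assms(4)] linear_maps_id
        chain_map_linear[OF f] chain_map_linear[OF g] chain_map_linear[OF chain_map_comp[OF f g]] | simp)+
qed

lemma tensor_chain_map_id:
  assumes "chain_complex R X" "chain_complex R V" "t \<in> carrier (Obj (tensor_complex R X V) n)"
  shows "tensor_chain_map R X V (\<lambda>n. id) (\<lambda>n. id) n t = t"
proof
  fix k
  show "tensor_chain_map R X V (\<lambda>n. id) (\<lambda>n. id) n t k = t k"
    unfolding tensor_chain_map_def
    by (rule tensor_map_id)
      (auto intro: chain_complex_module assms linear_maps_id tensor_complex_component)
qed

lemma homotopy_equivalence_tensor:
  assumes X: "chain_complex R X" and Y: "chain_complex R Y" and V: "chain_complex R V"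
    and "homotopy_equivalence R X Y f"
  shows "homotopy_equivalence R (tensor_complex R X V) (tensor_complex R Y V)
    (tensor_chain_map R Y V f (\<lambda>n. id))"
proof -
  obtain g where f: "chain_map R X Y f" and g: "chain_map R Y X g"
    and gf: "chain_homotopic R X X (\<lambda>n. g n \<circ> f n) (\<lambda>n. id)"
    and fg: "chain_homotopic R Y Y (\<lambda>n. f n \<circ> g n) (\<lambda>n. id)"
    using assms(4) unfolding homotopy_equivalence_def by blast
  \<comment> \<open>One half of the claim, stated for arbitrary complexes so that it can be used a
    second time with the roles of \<open>f\<close> and \<open>g\<close> exchanged.\<close>
  have retract: "chain_homotopic R (tensor_complex R X V) (tensor_complex R X V)
      (\<lambda>n. tensor_chain_map R X V g (\<lambda>n. id) n \<circ> tensor_chain_map R Y V f (\<lambda>n. id) n) (\<lambda>n. id)"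
    if "chain_complex R X" "chain_complex R Y" "chain_map R X Y f" "chain_map R Y X g"
      "chain_homotopic R X X (\<lambda>n. g n \<circ> f n) (\<lambda>n. id)" for X Y f g
    by (rule chain_homotopic_cong[OF chain_homotopic_tensor[OF that(1,1) V
            chain_map_comp[OF that(3,4)] chain_map_id that(5)]])
      (simp_all add: tensor_chain_map_comp_left[OF that(1,2,1) V that(3,4)] tensor_chain_map_id[OF that(1) V])
  show ?thesis
    unfolding homotopy_equivalence_def
    using tensor_chain_map_chain_map[OF X V Y V f chain_map_id]
      tensor_chain_map_chain_map[OF Y V X V g chain_map_id] retract[OF X Y f g gf] retract[OF Y X g f fg]
    by blast
qed

section \<open>The symmetric braiding\<close>

definition tensor_swap ::
    "('r, 'e) ring_scheme \<Rightarrow> ('r, 'a, 'c) module_scheme \<Rightarrow> ('r, 'b, 'd) module_scheme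
      \<Rightarrow> ('a \<times> 'b \<Rightarrow> 'r) set \<Rightarrow> ('b \<times> 'a \<Rightarrow> 'r) set"
  where "tensor_swap R M N = tensor_lift R (tensor R N M) (\<lambda>x y. pure_tensor R N M y x)"

lemma bilinear_map_flip: "bilinear_map R M N Q b \<Longrightarrow> bilinear_map R N M Q (\<lambda>y x. b x y)"
  by (simp add: bilinear_map_def)

lemma tensor_swap_linear:
  assumes "module R M" "module R N"
  shows "tensor_swap R M N \<in> linear_maps R (tensor R M N) (tensor R N M)"
  unfolding tensor_swap_def
  by (intro tensor_lift_linear bilinear_map_flip[OF pure_tensor_bilinear] module_tensor assms)

lemma tensor_swap_pure:
  assumes "module R M" "module R N" "x \<in> carrier M" "y \<in> carrier N"
  shows "tensor_swap R M N (pure_tensor R M N x y) = pure_tensor R N M y x"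
  unfolding tensor_swap_def
  by (rule tensor_lift_pure)
    (intro bilinear_map_flip[OF pure_tensor_bilinear] module_tensor assms)+

lemma tensor_swap_swap:
  assumes "module R M" "module R N" "t \<in> carrier (tensor R M N)"
  shows "tensor_swap R N M (tensor_swap R M N t) = t"
proof -
  have "tensor_swap R N M (tensor_swap R M N t) = id t"
    by (rule tensor_linear_maps_eqI[OF assms linear_maps_comp[OF tensor_swap_linear tensor_swap_linear]
          linear_maps_id])
      (simp_all add: assms tensor_swap_pure)
  then show ?thesis by simp
qed

lemma tensor_swap_map:
  assumes "module R M" "module R N" "module R M'" "module R N'"
    and f: "f \<in> linear_maps R M M'" and g: "g \<in> linear_maps R N N'"
    and t: "t \<in> carrier (tensor R M N)"
  shows "tensor_swap R M' N' (tensor_map R M' N' f g t) = tensor_map R N' M' g f (tensor_swap R M N t)"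
  by (rule tensor_linear_maps_eqI[OF assms(1,2) t
        linear_maps_comp[OF tensor_map_linear tensor_swap_linear]
        linear_maps_comp[OF tensor_swap_linear tensor_map_linear]])
    (simp_all add: assms tensor_swap_pure tensor_map_pure[where M = M and N = N]
      tensor_map_pure[where M = N and N = M] linear_maps_closed[OF f] linear_maps_closed[OF g])

text \<open>The Koszul sign makes the swap commute with the differentials.\<close>

definition braiding ::
    "('r, 'e) ring_scheme \<Rightarrow> ('r, 'x) chain_cplx \<Rightarrow> ('r, 'y) chain_cplx
      \<Rightarrow> int \<Rightarrow> (int \<Rightarrow> ('x \<times> 'y \<Rightarrow> 'r) set) \<Rightarrow> (int \<Rightarrow> ('y \<times> 'x \<Rightarrow> 'r) set)"
  where "braiding R X Y n t = (\<lambda>k. neg_one_pow (tensor R (Obj Y k) (Obj X (n - k))) (k * (n - k))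
    (tensor_swap R (Obj X (n - k)) (Obj Y k) (t (n - k))))"

text \<open>On indices the braiding is the reflection \<open>k \<mapsto> n - k\<close>, which is
  injective, so finite support is preserved.\<close>

lemma braiding_linear:
  assumes X: "chain_complex R X" and Y: "chain_complex R Y"
  shows "braiding R X Y n \<in> linear_maps R (Obj (tensor_complex R X Y) n) (Obj (tensor_complex R Y X) n)"
  unfolding tensor_complex_simps braiding_def[abs_def]
proof (rule direct_sum_map_linear[where h = "\<lambda>k. n - k"])
  note mods = chain_complex_module[OF X] chain_complex_module[OF Y]
  fix k
  have ix: "n - (n - k) = k" by simp
  show "(\<lambda>t. neg_one_pow (tensor R (Obj Y k) (Obj X (n - k))) (k * (n - k))
          (tensor_swap R (Obj X (n - k)) (Obj Y k) t))
      \<in> linear_maps R (tensor R (Obj X (n - k)) (Obj Y (n - (n - k)))) (tensor R (Obj Y k) (Obj X (n - k)))"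
    unfolding ix by (intro linear_maps_comp[OF tensor_swap_linear neg_one_pow_linear] module_tensor mods)
qed (auto intro!: module_tensor chain_complex_module X Y injI)

lemma braiding_braiding:
  assumes X: "chain_complex R X" and Y: "chain_complex R Y"
    and t: "t \<in> carrier (Obj (tensor_complex R X Y) n)"
  shows "braiding R Y X n (braiding R X Y n t) = t"
proof
  note mods = chain_complex_module[OF X] chain_complex_module[OF Y]
  fix k
  let ?T = "tensor R (Obj X k) (Obj Y (n - k))" and ?S = "tensor R (Obj Y (n - k)) (Obj X k)"
  let ?s = "tensor_swap R (Obj X k) (Obj Y (n - k)) (t k)"
  have T: "module R ?T" and S: "module R ?S" by (intro module_tensor mods)+
  have tk: "t k \<in> carrier ?T" using t by (rule tensor_complex_component) simp
  have s: "?s \<in> carrier ?S" by (intro linear_maps_closed[OF tensor_swap_linear] mods tk)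
  have "braiding R Y X n (braiding R X Y n t) k
      = neg_one_pow ?T (k * (n - k)) (tensor_swap R (Obj Y (n - k)) (Obj X k) (neg_one_pow ?S ((n - k) * k) ?s))"
    by (simp add: braiding_def)
  also have "\<dots> = neg_one_pow ?T (k * (n - k)) (neg_one_pow ?T ((n - k) * k) (t k))"
    by (simp add: linear_maps_neg_one_pow[OF S T tensor_swap_linear s] mods tensor_swap_swap tk)
  \<comment> \<open>The two exponents add up to twice \<open>k * (n - k)\<close>, so the signs
    cancel.\<close>
  also have "\<dots> = t k"
    by (subst neg_one_pow_neg_one_pow[OF T tk]) (simp add: neg_one_pow_def)
  finally show "braiding R Y X n (braiding R X Y n t) k = t k" .
qed

lemma braiding_Dif:
  assumes X: "chain_complex R X" and Y: "chain_complex R Y"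
    and t: "t \<in> carrier (Obj (tensor_complex R X Y) n)"
  shows "braiding R X Y (n + 1) (Dif (tensor_complex R X Y) n t)
    = Dif (tensor_complex R Y X) n (braiding R X Y n t)"
proof
  note mods = chain_complex_module[OF X] chain_complex_module[OF Y]
  note lin = chain_complex_Dif[OF X] chain_complex_Dif[OF Y] chain_complex_Dif'[OF Y] linear_maps_id
  fix k
  \<comment> \<open>Output component \<open>k\<close> lies in \<open>Y_k\<close> tensored with
    \<open>X_(j+1)\<close>. It receives d x from component \<open>j\<close> of \<open>t\<close> and
    d y from component \<open>j + 1\<close>.\<close>
  define j where "j = n - k"
  have ix: "n + 1 - k = j + 1" "n - k = j" "n - (k - 1) = j + 1" "n + 1 - (j + 1) = k"
      "n - (j + 1) = k - 1" "j + 1 - 1 = j"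
    by (simp_all add: j_def)
  let ?S = "tensor R (Obj X (j + 1)) (Obj Y k)" and ?T = "tensor R (Obj Y k) (Obj X (j + 1))"
  let ?sw = "tensor_swap R (Obj X (j + 1)) (Obj Y k)"
  let ?map = "tensor_map R (Obj Y k) (Obj X (j + 1))"
  let ?map' = "tensor_map R (Obj X (j + 1)) (Obj Y k)"
  let ?u = "tensor_swap R (Obj X (j + 1)) (Obj Y (k - 1)) (t (j + 1))"
  let ?v = "tensor_swap R (Obj X j) (Obj Y k) (t j)"
  have S: "module R ?S" and T: "module R ?T"
    and U: "module R (tensor R (Obj Y (k - 1)) (Obj X (j + 1)))" and V: "module R (tensor R (Obj Y k) (Obj X j))"
    by (intro module_tensor mods)+
  interpret T: module R ?T by (rule T)
  have t1: "t (j + 1) \<in> carrier (tensor R (Obj X (j + 1)) (Obj Y (k - 1)))"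
    and t2: "t j \<in> carrier (tensor R (Obj X j) (Obj Y k))"
    using t by (auto intro!: tensor_complex_component simp: j_def)
  have u: "?u \<in> carrier (tensor R (Obj Y (k - 1)) (Obj X (j + 1)))"
    and v: "?v \<in> carrier (tensor R (Obj Y k) (Obj X j))"
    by (intro linear_maps_closed[OF tensor_swap_linear] mods t1 t2)+
  have sw: "?sw \<in> linear_maps R ?S ?T"
    by (intro tensor_swap_linear mods)
  have M: "?map (Dif Y (k - 1)) id \<in> linear_maps R (tensor R (Obj Y (k - 1)) (Obj X (j + 1))) ?T"
    and N: "?map id (Dif X j) \<in> linear_maps R (tensor R (Obj Y k) (Obj X j)) ?T"
    by (intro tensor_map_linear mods lin)+
  have p: "?map' (Dif X j) id (t j) \<in> carrier ?S"
    and q: "?map' id (Dif Y (k - 1)) (t (j + 1)) \<in> carrier ?S"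
    by (rule linear_maps_closed[OF tensor_map_linear t1] linear_maps_closed[OF tensor_map_linear t2];
        intro mods lin)+
  have sp: "?sw (?map' (Dif X j) id (t j)) = ?map id (Dif X j) ?v"
    by (intro tensor_swap_map mods lin t2)
  have sq: "?sw (?map' id (Dif Y (k - 1)) (t (j + 1))) = ?map (Dif Y (k - 1)) id ?u"
    by (intro tensor_swap_map mods lin t1)
  let ?p = "?map id (Dif X j) ?v" and ?q = "?map (Dif Y (k - 1)) id ?u"
  have P: "?p \<in> carrier ?T" and Q: "?q \<in> carrier ?T"
    by (intro linear_maps_closed[OF M] linear_maps_closed[OF N] u v)+
  have "braiding R X Y (n + 1) (Dif (tensor_complex R X Y) n t) k
      = neg_one_pow ?T (k * (j + 1)) (?sw (?map' (Dif X j) id (t j) \<oplus>\<^bsub>?S\<^esub>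
          neg_one_pow ?S (j + 1) (?map' id (Dif Y (k - 1)) (t (j + 1)))))"
    by (simp only: braiding_def tensor_complex_simps ix)
  also have "\<dots> = neg_one_pow ?T (k * (j + 1)) ?p
      \<oplus>\<^bsub>?T\<^esub> neg_one_pow ?T (k * (j + 1)) (neg_one_pow ?T (j + 1) ?q)"
    using P Q p q
    by (simp add: linear_maps_add[OF sw] neg_one_pow_closed[OF S] neg_one_pow_closed[OF T]
        linear_maps_neg_one_pow[OF S T sw] sp sq linear_maps_add[OF neg_one_pow_linear[OF T]])
  \<comment> \<open>The parity check behind the Koszul sign: \<open>k * (j + 1)\<close> equals
    \<open>k + k * j\<close>, and \<open>k * (j + 1) + (j + 1) = (k + 1) * (j + 1)\<close> has the
    parity of \<open>(k - 1) * (j + 1)\<close>.\<close>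
  also have "\<dots> = neg_one_pow ?T ((k - 1) * (j + 1)) ?q
      \<oplus>\<^bsub>?T\<^esub> neg_one_pow ?T k (neg_one_pow ?T (k * j) ?p)"
    using P Q by (simp add: neg_one_pow_neg_one_pow[OF T] T.a_comm neg_one_pow_closed[OF T])
      (intro arg_cong2[where f = "add ?T"] neg_one_pow_cong; simp; blast)
  also have "\<dots> = ?map (Dif Y (k - 1)) id (neg_one_pow (tensor R (Obj Y (k - 1)) (Obj X (j + 1))) ((k - 1) * (j + 1)) ?u)
      \<oplus>\<^bsub>?T\<^esub> neg_one_pow ?T k (?map id (Dif X j) (neg_one_pow (tensor R (Obj Y k) (Obj X j)) (k * j) ?v))"
    by (simp add: linear_maps_neg_one_pow[OF U T M u] linear_maps_neg_one_pow[OF V T N v])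
  also have "\<dots> = Dif (tensor_complex R Y X) n (braiding R X Y n t) k"
    by (simp only: braiding_def tensor_complex_simps ix)
  finally show "braiding R X Y (n + 1) (Dif (tensor_complex R X Y) n t) k
    = Dif (tensor_complex R Y X) n (braiding R X Y n t) k" .
qed

text \<open>The braiding in the opposite order is a two-sided inverse in every degree.\<close>

lemma braiding_isomorphism:
  assumes X: "chain_complex R X" and Y: "chain_complex R Y"
  shows "chain_isomorphism R (tensor_complex R X Y) (tensor_complex R Y X) (braiding R X Y)"
  unfolding chain_isomorphism_def chain_map_def
proof (intro conjI allI ballI)
  fix n
  show "bij_betw (braiding R X Y n) (carrier (Obj (tensor_complex R X Y) n))
      (carrier (Obj (tensor_complex R Y X) n))"
    by (rule bij_betw_byWitness[where f' = "braiding R Y X n"])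
      (auto simp: braiding_braiding assms linear_maps_closed[OF braiding_linear])
qed (auto simp: braiding_linear braiding_Dif assms)

text \<open>Chain maps preserve degrees, so the same sign appears on both sides and naturality
  reduces to that of the unsigned swap.\<close>

lemma braiding_natural:
  assumes X: "chain_complex R X" and Y: "chain_complex R Y"
    and X': "chain_complex R X'" and Y': "chain_complex R Y'"
    and f: "chain_map R X X' f" and g: "chain_map R Y Y' g"
    and t: "t \<in> carrier (Obj (tensor_complex R X Y) n)"
  shows "braiding R X' Y' n (tensor_chain_map R X' Y' f g n t)
    = tensor_chain_map R Y' X' g f n (braiding R X Y n t)"
proof
  note mods = chain_complex_module[OF X] chain_complex_module[OF Y]
    chain_complex_module[OF X'] chain_complex_module[OF Y']
  note lin = chain_map_linear[OF f] chain_map_linear[OF g]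
  fix k
  have ix: "n - (n - k) = k" by simp
  have t': "t (n - k) \<in> carrier (tensor R (Obj X (n - k)) (Obj Y k))"
    using t by (rule tensor_complex_component) simp
  have s: "tensor_swap R (Obj X (n - k)) (Obj Y k) (t (n - k)) \<in> carrier (tensor R (Obj Y k) (Obj X (n - k)))"
    by (intro linear_maps_closed[OF tensor_swap_linear] mods t')
  show "braiding R X' Y' n (tensor_chain_map R X' Y' f g n t) k
    = tensor_chain_map R Y' X' g f n (braiding R X Y n t) k"
    unfolding braiding_def tensor_chain_map_def ix
    by (subst linear_maps_neg_one_pow[OF module_tensor module_tensor tensor_map_linear s])
      (intro mods lin | simp add: tensor_swap_map[OF mods(1,2,3,4) lin t'])+
qed

text \<open>The witness \<open>braiding R L\<close> is polymorphic in the second complex, which is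
  why the type parameter \<open>T\<close> may be arbitrary.\<close>

lemma scalar_object_chain_complex:
  assumes "chain_complex R L"
  shows "scalar_object T R L"
  unfolding scalar_object_def
  by (rule exI[where x = "braiding R L"])
    (auto simp: fg_free_complex_def assms braiding_isomorphism
      intro!: braiding_natural[OF assms _ assms _ chain_map_id])

section \<open>The base ring as a complex\<close>

lemma module_ring_module:
  assumes "cring R" shows "module R (ring_module R)"
proof -
  interpret R: cring R by fact
  show ?thesis
    by (intro moduleI abelian_groupI)
      (auto simp: ring_module_def R.a_ac R.l_distr R.r_distr R.m_assoc R.is_cring intro: R.l_neg R.a_inv_closed)
qed

lemma fg_free_ring_module:
  assumes "cring R" shows "fg_free R (ring_module R)"
proof -
  interpret R: cring R by fact
  interpret M: module R "ring_module R" by (rule module_ring_module) fact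
  have [simp]: "carrier (ring_module R) = carrier R" "a \<odot>\<^bsub>ring_module R\<^esub> x = a \<otimes>\<^bsub>R\<^esub> x" for a x
    by (simp_all add: ring_module_def)
  have sum: "(\<Oplus>\<^bsub>ring_module R\<^esub>b\<in>{\<one>\<^bsub>R\<^esub>}. c b \<odot>\<^bsub>ring_module R\<^esub> b) = c \<one>\<^bsub>R\<^esub>"
    if "c \<in> {\<one>\<^bsub>R\<^esub>} \<rightarrow>\<^sub>E carrier R" for c
  proof -
    have "c \<one>\<^bsub>R\<^esub> \<in> carrier R" using that by auto
    then show ?thesis using M.r_zero[of "c \<one>\<^bsub>R\<^esub>"] by (subst M.finsum_insert) simp_all
  qed
  have "\<exists>!c. c \<in> {\<one>\<^bsub>R\<^esub>} \<rightarrow>\<^sub>E carrier R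
      \<and> x = (\<Oplus>\<^bsub>ring_module R\<^esub>b\<in>{\<one>\<^bsub>R\<^esub>}. c b \<odot>\<^bsub>ring_module R\<^esub> b)" if "x \<in> carrier R" for x
  proof (rule ex1I)
    \<comment> \<open>Coordinate families are extensional functions, so the coefficient of the basis
      vector 1 is given as a restricted function; uniqueness would fail otherwise.\<close>
    have c: "(\<lambda>b\<in>{\<one>\<^bsub>R\<^esub>}. x) \<in> {\<one>\<^bsub>R\<^esub>} \<rightarrow>\<^sub>E carrier R" using that by auto
    show "(\<lambda>b\<in>{\<one>\<^bsub>R\<^esub>}. x) \<in> {\<one>\<^bsub>R\<^esub>} \<rightarrow>\<^sub>E carrier R
        \<and> x = (\<Oplus>\<^bsub>ring_module R\<^esub>b\<in>{\<one>\<^bsub>R\<^esub>}. (\<lambda>b\<in>{\<one>\<^bsub>R\<^esub>}. x) b \<odot>\<^bsub>ring_module R\<^esub> b)"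
      using c by (subst sum[OF c]) simp
  next
    fix c assume c: "c \<in> {\<one>\<^bsub>R\<^esub>} \<rightarrow>\<^sub>E carrier R
      \<and> x = (\<Oplus>\<^bsub>ring_module R\<^esub>b\<in>{\<one>\<^bsub>R\<^esub>}. c b \<odot>\<^bsub>ring_module R\<^esub> b)"
    then have "x = c \<one>\<^bsub>R\<^esub>" using sum by simp
    then show "c = (\<lambda>b\<in>{\<one>\<^bsub>R\<^esub>}. x)"
      using c by (intro extensionalityI[of _ "{\<one>\<^bsub>R\<^esub>}"]) (auto simp: PiE_def)
  qed
  then show ?thesis
    unfolding fg_free_def using M.module_axioms by (intro conjI exI[where x = "{\<one>\<^bsub>R\<^esub>}"]) auto
qed

text \<open>The empty set is a basis: there is exactly one extensional family on it, and its empty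
  sum is the only element.\<close>

lemma fg_free_zero:
  assumes "module R M" "carrier M = {\<zero>\<^bsub>M\<^esub>}"
  shows "fg_free R M"
proof -
  interpret M: module R M by fact
  show ?thesis
    unfolding fg_free_def using assms by (intro conjI exI[where x = "{}"]) auto
qed

lemma fg_free_complex_ring_complex:
  assumes "cring R" shows "fg_free_complex R (ring_complex R)"
proof -
  interpret M: module R "ring_module R" by (rule module_ring_module) fact
  \<comment> \<open>Away from degree 0 the complex consists of the zero submodule, encoded by
    shrinking the carrier of the ring module.\<close>
  have "submodule {\<zero>\<^bsub>ring_module R\<^esub>} R (ring_module R)"
    by (rule M.submoduleI) auto
  then have Z: "module R ((ring_module R)\<lparr>carrier := {\<zero>\<^bsub>ring_module R\<^esub>}\<rparr>)"
    by (rule submodule.submodule_is_module) (rule M.module_axioms)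
  have zero: "\<zero>\<^bsub>ring_module R\<^esub> = \<zero>\<^bsub>R\<^esub>" by (simp add: ring_module_def)
  have free: "fg_free R (Obj (ring_complex R) n)" for n
    using fg_free_ring_module[OF assms] fg_free_zero[OF Z] by (simp add: ring_complex_def zero)
  then have mod: "module R (Obj (ring_complex R) n)" for n
    by (simp add: fg_free_def)
  have 0: "\<zero>\<^bsub>Obj (ring_complex R) n\<^esub> = \<zero>\<^bsub>R\<^esub>" for n by (simp add: ring_complex_def zero)
  have "Dif (ring_complex R) n \<in> linear_maps R (Obj (ring_complex R) n) (Obj (ring_complex R) (n + 1))" for n
  proof -
    have "Dif (ring_complex R) n = (\<lambda>x. \<zero>\<^bsub>Obj (ring_complex R) (n + 1)\<^esub>)"
      unfolding 0 by (simp add: ring_complex_def)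
    then show ?thesis by (simp only: linear_maps_const_zero[OF mod])
  qed
  then show ?thesis
    unfolding fg_free_complex_def chain_complex_def using free mod 0 by (simp add: ring_complex_def)
qed

section \<open>Splittings\<close>

text \<open>The sum being everything gives a decomposition of each element, and the trivial
  intersection makes its \<open>B\<close>-part unique. Uniqueness yields linearity, since adding or
  scaling decompositions gives decompositions.\<close>

lemma internal_direct_sum_projection:
  assumes "module R M" "submodule G R M" "submodule B R M" "internal_direct_sum M G B"
  obtains \<pi> where "\<pi> \<in> linear_maps R M M" "\<And>x. x \<in> carrier M \<Longrightarrow> \<pi> x \<in> B" "\<And>x. x \<in> B \<Longrightarrow> \<pi> x = x"
proof -
  interpret M: module R M by fact
  note G = M.submoduleE[OF assms(2)] and B = M.submoduleE[OF assms(3)]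
  have GM: "x \<in> carrier M" if "x \<in> G" for x using G(1) that by auto
  have BM: "x \<in> carrier M" if "x \<in> B" for x using B(1) that by auto
  have sum: "G <+>\<^bsub>M\<^esub> B = carrier M" and Int: "G \<inter> B = {\<zero>\<^bsub>M\<^esub>}"
    using assms(4) by (auto simp: internal_direct_sum_def)
  have unique: "b = b'" if "b \<in> B" "b' \<in> B" "g \<in> G" "g' \<in> G" "g \<oplus>\<^bsub>M\<^esub> b = g' \<oplus>\<^bsub>M\<^esub> b'" for b b' g g'
  proof -
    note [simp] = GM[OF that(3)] GM[OF that(4)] BM[OF that(1)] BM[OF that(2)]
    \<comment> \<open>Equality of the two sums rewrites the difference of the \<open>B\<close>-parts
      as a difference of \<open>G\<close>-parts, which places it in the trivial
      intersection.\<close>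
    have "b \<ominus>\<^bsub>M\<^esub> b' = \<ominus>\<^bsub>M\<^esub> g \<oplus>\<^bsub>M\<^esub> (g \<oplus>\<^bsub>M\<^esub> b) \<oplus>\<^bsub>M\<^esub> \<ominus>\<^bsub>M\<^esub> b'"
      by (simp add: a_minus_def M.r_neg1)
    also have "\<dots> = g' \<ominus>\<^bsub>M\<^esub> g"
      unfolding that(5) by (simp add: a_minus_def M.a_assoc M.r_neg M.a_comm[of "\<ominus>\<^bsub>M\<^esub> g" g'])
    finally have "b \<ominus>\<^bsub>M\<^esub> b' = g' \<ominus>\<^bsub>M\<^esub> g" .
    moreover have "b \<ominus>\<^bsub>M\<^esub> b' \<in> B" "g' \<ominus>\<^bsub>M\<^esub> g \<in> G"
      using that B(3,5) G(3,5) by (simp_all add: a_minus_def)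
    ultimately have "b \<ominus>\<^bsub>M\<^esub> b' = \<zero>\<^bsub>M\<^esub>" using Int by auto
    then show ?thesis
      using M.minus_equality[of b "\<ominus>\<^bsub>M\<^esub> b'"] by (simp add: a_minus_def)
  qed
  have "\<exists>b. b \<in> B \<and> (\<exists>g\<in>G. x = g \<oplus>\<^bsub>M\<^esub> b)" if "x \<in> carrier M" for x
    using that unfolding sum[symmetric] set_add_def' by auto
  then obtain \<pi> where \<pi>: "\<And>x. x \<in> carrier M \<Longrightarrow> \<pi> x \<in> B \<and> (\<exists>g\<in>G. x = g \<oplus>\<^bsub>M\<^esub> \<pi> x)"
    by metis
  have eq: "\<pi> x = b" if "b \<in> B" "g \<in> G" "x = g \<oplus>\<^bsub>M\<^esub> b" for x b g
    using \<pi>[of x] unique[of "\<pi> x" b _ g] that GM BM by auto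
  show thesis
  proof
    show "\<pi> \<in> linear_maps R M M"
    proof (rule linear_mapsI)
      fix x y assume "x \<in> carrier M" "y \<in> carrier M"
      then obtain g h where gh: "g \<in> G" "h \<in> G" "x = g \<oplus>\<^bsub>M\<^esub> \<pi> x" "y = h \<oplus>\<^bsub>M\<^esub> \<pi> y" and B': "\<pi> x \<in> B" "\<pi> y \<in> B"
        using \<pi> by metis
      have "(g \<oplus>\<^bsub>M\<^esub> \<pi> x) \<oplus>\<^bsub>M\<^esub> (h \<oplus>\<^bsub>M\<^esub> \<pi> y) = (g \<oplus>\<^bsub>M\<^esub> h) \<oplus>\<^bsub>M\<^esub> (\<pi> x \<oplus>\<^bsub>M\<^esub> \<pi> y)"
        using GM BM gh(1,2) B' by (simp add: M.a_ac)
      then show "\<pi> (x \<oplus>\<^bsub>M\<^esub> y) = \<pi> x \<oplus>\<^bsub>M\<^esub> \<pi> y"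
        using gh B' G(5) B(5) by (intro eq[of _ "g \<oplus>\<^bsub>M\<^esub> h"]) auto
    next
      fix a x assume a: "a \<in> carrier R" and "x \<in> carrier M"
      then obtain g where g: "g \<in> G" "x = g \<oplus>\<^bsub>M\<^esub> \<pi> x" and B': "\<pi> x \<in> B"
        using \<pi> by metis
      have "a \<odot>\<^bsub>M\<^esub> (g \<oplus>\<^bsub>M\<^esub> \<pi> x) = a \<odot>\<^bsub>M\<^esub> g \<oplus>\<^bsub>M\<^esub> a \<odot>\<^bsub>M\<^esub> \<pi> x"
        using GM BM g(1) B' a by (simp add: M.smult_r_distr)
      then show "\<pi> (a \<odot>\<^bsub>M\<^esub> x) = a \<odot>\<^bsub>M\<^esub> \<pi> x"
        using g B' G(4) B(4) a by (intro eq[of _ "a \<odot>\<^bsub>M\<^esub> g"]) auto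
    qed (use \<pi> BM in auto)
    show "\<pi> x = x" if "x \<in> B" for x
      using that BM Int by (intro eq[of x "\<zero>\<^bsub>M\<^esub>"]) auto
  qed (use \<pi> in auto)
qed

lemma linear_maps_finsum:
  assumes "module R M" "module R N" "f \<in> linear_maps R M N" "finite A" "g \<in> A \<rightarrow> carrier M"
  shows "f (\<Oplus>\<^bsub>M\<^esub>i\<in>A. g i) = (\<Oplus>\<^bsub>N\<^esub>i\<in>A. f (g i))"
proof -
  interpret M: module R M by fact
  interpret N: module R N by fact
  show ?thesis
    using assms(4,5)
  proof (induction A rule: finite_induct)
    case empty
    then show ?case by (simp add: linear_maps_zero[OF assms(1-3)])
  next
    case (insert i A)
    then show ?case
      using linear_maps_closed[OF assms(3)]
      by (simp add: M.finsum_insert N.finsum_insert linear_maps_add[OF assms(3)] Pi_iff M.finsum_closed)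
  qed
qed

text \<open>Choose preimages of the images of the basis vectors and extend linearly through
  coordinates. The lifting condition concerns only the image of \<open>h\<close>, so the lemma
  covers a differential \<open>d\<close> that is not surjective.\<close>

lemma fg_free_projective:
  assumes "fg_free R M" and P: "module R P" and N: "module R N"
    and h: "h \<in> linear_maps R M N" and d: "d \<in> linear_maps R P N"
    and im: "\<And>x. x \<in> carrier M \<Longrightarrow> h x \<in> d ` carrier P"
  obtains \<sigma> where "\<sigma> \<in> linear_maps R M P" "\<And>x. x \<in> carrier M \<Longrightarrow> d (\<sigma> x) = h x"
proof -
  have M: "module R M" using assms(1) by (simp add: fg_free_def)
  interpret M: module R M by (rule M)
  interpret P: module R P by (rule P)
  interpret N: module R N by (rule N)
  obtain B where B: "finite B" "B \<subseteq> carrier M"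
    and ex: "\<And>x. x \<in> carrier M \<Longrightarrow>
      \<exists>!c. c \<in> B \<rightarrow>\<^sub>E carrier R \<and> x = (\<Oplus>\<^bsub>M\<^esub>b\<in>B. c b \<odot>\<^bsub>M\<^esub> b)"
    using assms(1) by (auto simp: fg_free_def)
  obtain C where C: "\<And>x. x \<in> carrier M \<Longrightarrow> C x \<in> B \<rightarrow>\<^sub>E carrier R \<and> x = (\<Oplus>\<^bsub>M\<^esub>b\<in>B. C x b \<odot>\<^bsub>M\<^esub> b)"
    using ex by metis
  have CR [simp]: "C x b \<in> carrier R" if "x \<in> carrier M" "b \<in> B" for x b
    using C[OF that(1)] that(2) by auto
  have BM [simp]: "b \<in> carrier M" if "b \<in> B" for b using B(2) that by auto
  \<comment> \<open>\<open>C\<close> is a choice of coordinates. Any other expansion of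
    \<open>x\<close> has the same coefficients on \<open>B\<close>, once it is restricted to
    \<open>B\<close> so as to fall under the uniqueness of extensional families.\<close>
  have coord: "C x b = c b"
    if "c \<in> B \<rightarrow> carrier R" "x = (\<Oplus>\<^bsub>M\<^esub>b\<in>B. c b \<odot>\<^bsub>M\<^esub> b)" "b \<in> B" for x c b
  proof -
    have x: "x \<in> carrier M"
      unfolding that(2) using that(1) by (intro M.finsum_closed) (auto simp: Pi_iff)
    have "x = (\<Oplus>\<^bsub>M\<^esub>b\<in>B. restrict c B b \<odot>\<^bsub>M\<^esub> b)"
      unfolding that(2) using that(1) by (intro M.finsum_cong') (auto simp: Pi_iff)
    moreover have "restrict c B \<in> B \<rightarrow>\<^sub>E carrier R" using that(1) by auto
    ultimately have "C x = restrict c B" using ex[OF x] C[OF x] by blast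
    then show ?thesis using that(3) by simp
  qed
  have "\<exists>p. p \<in> carrier P \<and> d p = h b" if "b \<in> B" for b
    using im[OF BM[OF that]] by auto
  then obtain s where s: "\<And>b. b \<in> B \<Longrightarrow> s b \<in> carrier P" "\<And>b. b \<in> B \<Longrightarrow> d (s b) = h b"
    by metis
  define \<sigma> where "\<sigma> x = (\<Oplus>\<^bsub>P\<^esub>b\<in>B. C x b \<odot>\<^bsub>P\<^esub> s b)" for x
  show thesis
  proof
    show "\<sigma> \<in> linear_maps R M P"
    proof (rule linear_mapsI)
      show "\<sigma> x \<in> carrier P" if "x \<in> carrier M" for x
        unfolding \<sigma>_def using s that by (intro P.finsum_closed) auto
    next
      fix x y assume xy: "x \<in> carrier M" "y \<in> carrier M"
      have "x \<oplus>\<^bsub>M\<^esub> y = (\<Oplus>\<^bsub>M\<^esub>b\<in>B. C x b \<odot>\<^bsub>M\<^esub> b) \<oplus>\<^bsub>M\<^esub> (\<Oplus>\<^bsub>M\<^esub>b\<in>B. C y b \<odot>\<^bsub>M\<^esub> b)"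
        using C xy by metis
      also have "\<dots> = (\<Oplus>\<^bsub>M\<^esub>b\<in>B. C x b \<odot>\<^bsub>M\<^esub> b \<oplus>\<^bsub>M\<^esub> C y b \<odot>\<^bsub>M\<^esub> b)"
        using xy by (intro M.finsum_addf[symmetric]) auto
      also have "\<dots> = (\<Oplus>\<^bsub>M\<^esub>b\<in>B. (C x b \<oplus>\<^bsub>R\<^esub> C y b) \<odot>\<^bsub>M\<^esub> b)"
        using xy by (intro M.finsum_cong') (auto simp: M.smult_l_distr)
      finally have "C (x \<oplus>\<^bsub>M\<^esub> y) b = C x b \<oplus>\<^bsub>R\<^esub> C y b" if "b \<in> B" for b
        using xy that by (intro coord) auto
      then have "\<sigma> (x \<oplus>\<^bsub>M\<^esub> y) = (\<Oplus>\<^bsub>P\<^esub>b\<in>B. C x b \<odot>\<^bsub>P\<^esub> s b \<oplus>\<^bsub>P\<^esub> C y b \<odot>\<^bsub>P\<^esub> s b)"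
        unfolding \<sigma>_def using xy s by (intro P.finsum_cong') (auto simp: P.smult_l_distr)
      also have "\<dots> = \<sigma> x \<oplus>\<^bsub>P\<^esub> \<sigma> y"
        unfolding \<sigma>_def using xy s by (intro P.finsum_addf) auto
      finally show "\<sigma> (x \<oplus>\<^bsub>M\<^esub> y) = \<sigma> x \<oplus>\<^bsub>P\<^esub> \<sigma> y" .
    next
      fix a x assume a: "a \<in> carrier R" and x: "x \<in> carrier M"
      have "a \<odot>\<^bsub>M\<^esub> x = a \<odot>\<^bsub>M\<^esub> (\<Oplus>\<^bsub>M\<^esub>b\<in>B. C x b \<odot>\<^bsub>M\<^esub> b)"
        using C x by metis
      also have "\<dots> = (\<Oplus>\<^bsub>M\<^esub>b\<in>B. a \<odot>\<^bsub>M\<^esub> (C x b \<odot>\<^bsub>M\<^esub> b))"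
        using a x B by (intro M.finsum_smult_ldistr) auto
      also have "\<dots> = (\<Oplus>\<^bsub>M\<^esub>b\<in>B. (a \<otimes>\<^bsub>R\<^esub> C x b) \<odot>\<^bsub>M\<^esub> b)"
        using a x by (intro M.finsum_cong') (auto simp: M.smult_assoc1)
      finally have "C (a \<odot>\<^bsub>M\<^esub> x) b = a \<otimes>\<^bsub>R\<^esub> C x b" if "b \<in> B" for b
        using a x that by (intro coord) auto
      then have "\<sigma> (a \<odot>\<^bsub>M\<^esub> x) = (\<Oplus>\<^bsub>P\<^esub>b\<in>B. a \<odot>\<^bsub>P\<^esub> (C x b \<odot>\<^bsub>P\<^esub> s b))"
        unfolding \<sigma>_def using a x s by (intro P.finsum_cong') (auto simp: P.smult_assoc1)
      also have "\<dots> = a \<odot>\<^bsub>P\<^esub> \<sigma> x"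
        unfolding \<sigma>_def using a x s B by (intro P.finsum_smult_ldistr[symmetric]) auto
      finally show "\<sigma> (a \<odot>\<^bsub>M\<^esub> x) = a \<odot>\<^bsub>P\<^esub> \<sigma> x" .
    qed
  next
    fix x assume x: "x \<in> carrier M"
    have "d (\<sigma> x) = (\<Oplus>\<^bsub>N\<^esub>b\<in>B. d (C x b \<odot>\<^bsub>P\<^esub> s b))"
      unfolding \<sigma>_def using x s by (intro linear_maps_finsum[OF P N d B(1)]) auto
    also have "\<dots> = (\<Oplus>\<^bsub>N\<^esub>b\<in>B. h (C x b \<odot>\<^bsub>M\<^esub> b))"
      using x s by (intro N.finsum_cong')
        (auto simp: linear_maps_smult[OF d] linear_maps_smult[OF h] linear_maps_closed[OF h])
    also have "\<dots> = h (\<Oplus>\<^bsub>M\<^esub>b\<in>B. C x b \<odot>\<^bsub>M\<^esub> b)"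
      using x by (intro linear_maps_finsum[OF M N h B(1), symmetric]) auto
    also have "\<dots> = h x" using C[OF x] by simp
    finally show "d (\<sigma> x) = h x" .
  qed
qed

section \<open>Cohomology\<close>

lemma linear_maps_restrict_carrier:
  "f \<in> linear_maps R M N \<Longrightarrow> K \<subseteq> carrier M \<Longrightarrow> f \<in> linear_maps R (M\<lparr>carrier := K\<rparr>) N"
  by (auto simp: linear_maps_def Pi_iff subset_iff)

lemma linear_maps_corestrict_carrier:
  "f \<in> linear_maps R M N \<Longrightarrow> (\<And>x. x \<in> carrier M \<Longrightarrow> f x \<in> K) \<Longrightarrow> f \<in> linear_maps R M (N\<lparr>carrier := K\<rparr>)"
  by (auto simp: linear_maps_def)

lemma chain_complex_cohomology_complex:
  assumes "\<And>n. module R (cohomology X n)"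
  shows "chain_complex R (cohomology_complex X)"
  unfolding chain_complex_def cohomology_complex_def
  using assms by (auto simp: linear_maps_const_zero ac_simps)

lemma cohomology_homotopy_equivalence:
  fixes R :: "('r, 'e) ring_scheme" and F :: "('r, 'm) chain_cplx"
  assumes free: "fg_free_complex R F"
    and split: "\<And>n. \<exists>G. submodule G R (Obj F n) \<and>
           internal_direct_sum (Obj F n) G (Dif F (n - 1) ` carrier (Obj F (n - 1)))"
  shows "\<exists>\<alpha>. homotopy_equivalence R (cohomology_complex F) F \<alpha>"
proof -
  have F: "chain_complex R F" and fg: "\<And>n. fg_free R (Obj F n)"
    using free by (simp_all add: fg_free_complex_def)
  note mod = chain_complex_module[OF F]
  interpret M: module R "Obj F n" for n by (rule mod)
  note d = chain_complex_Dif[OF F] and d' = chain_complex_Dif'[OF F]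
  have dd: "Dif F (n + 1) (Dif F n x) = \<zero>\<^bsub>Obj F (n + 2)\<^esub>" if "x \<in> carrier (Obj F n)" for n x
    using F that by (simp add: chain_complex_def)
  have dd': "Dif F n (Dif F (n - 1) x) = \<zero>\<^bsub>Obj F (n + 1)\<^esub>" if "x \<in> carrier (Obj F (n - 1))" for n x
    using dd[OF that] by (simp add: algebra_simps)
  define B where "B n = Dif F (n - 1) ` carrier (Obj F (n - 1))" for n
  define K where "K n = a_kernel (Obj F n) (Obj F (n + 1)) (Dif F n)" for n
  \<comment> \<open>The cocycles as a module in their own right; the cohomology is by definition its
    quotient by \<open>B\<close>.\<close>
  define Z where "Z n = (Obj F n)\<lparr>carrier := K n\<rparr>" for n
  have K_iff: "x \<in> K n \<longleftrightarrow> x \<in> carrier (Obj F n) \<and> Dif F n x = \<zero>\<^bsub>Obj F (n + 1)\<^esub>" for n x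
    by (auto simp: K_def a_kernel_def')
  have subB: "submodule (B n) R (Obj F n)" for n
    unfolding B_def by (rule submodule_image[OF mod mod d'])
  have subK: "submodule (K n) R (Obj F n)" for n
    unfolding K_def by (rule submodule_kernel[OF mod mod d])
  have BK: "x \<in> K n" if "x \<in> B n" for n x
    using that by (auto simp: B_def K_iff linear_maps_closed[OF d'] dd')
  have modZ: "module R (Z n)" for n
    unfolding Z_def by (rule submodule.submodule_is_module[OF subK mod])
  interpret Z: module R "Z n" for n by (rule modZ)
  have subZ: "submodule (B n) R (Z n)" for n
    unfolding Z_def using BK by (intro submodule_restrict_carrier[OF mod subK subB]) auto
  have H: "cohomology F n = quotient_module (Z n) (B n)" for n
    by (simp add: cohomology_def Z_def B_def K_def)
  have modH: "module R (cohomology F n)" for n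
    unfolding H by (rule module_quotient[OF modZ subZ])
  interpret H: module R "cohomology F n" for n by (rule modH)
  have Z_simps [simp]: "carrier (Z n) = K n" "add (Z n) = add (Obj F n)" for n
    by (simp_all add: Z_def)
  define q where "q n x = B n +>\<^bsub>Z n\<^esub> x" for n x
  have q: "q n \<in> linear_maps R (Z n) (cohomology F n)" for n
    unfolding H q_def[abs_def] by (rule quotient_proj_linear[OF modZ subZ])
  have qB: "q n x = \<zero>\<^bsub>cohomology F n\<^esub>" if "x \<in> B n" for n x
    using abelian_subgroup.a_rcos_const[OF submodule_abelian_subgroup[OF modZ subZ] that]
    by (simp add: H q_def quotient_module_def)
  have "\<exists>\<pi>. \<pi> \<in> linear_maps R (Obj F n) (Obj F n) \<and>
      (\<forall>x\<in>carrier (Obj F n). \<pi> x \<in> B n) \<and> (\<forall>x\<in>B n. \<pi> x = x)" for n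
  proof -
    obtain G where G: "submodule G R (Obj F n)" "internal_direct_sum (Obj F n) G (B n)"
      using split[of n] by (auto simp: B_def)
    show ?thesis by (rule internal_direct_sum_projection[OF mod G(1) subB G(2)]) blast
  qed
  then obtain \<pi> where \<pi>: "\<And>n. \<pi> n \<in> linear_maps R (Obj F n) (Obj F n)"
    and \<pi>B: "\<And>n x. x \<in> carrier (Obj F n) \<Longrightarrow> \<pi> n x \<in> B n" and \<pi>_id: "\<And>n x. x \<in> B n \<Longrightarrow> \<pi> n x = x"
    by metis
  have "\<exists>\<sigma>. \<sigma> \<in> linear_maps R (Obj F (n + 1)) (Obj F n) \<and>
      (\<forall>x\<in>carrier (Obj F (n + 1)). Dif F n (\<sigma> x) = \<pi> (n + 1) x)" for n
  proof -
    \<comment> \<open>Boundaries in degree \<open>n + 1\<close> are exactly the image of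
      \<open>Dif F n\<close>, so projectivity of the free module \<open>Obj F (n + 1)\<close>
      applies to \<pi>.\<close>
    have "\<pi> (n + 1) x \<in> Dif F n ` carrier (Obj F n)" if "x \<in> carrier (Obj F (n + 1))" for x
      using \<pi>B[OF that] by (simp add: B_def)
    then show ?thesis
      by (rule fg_free_projective[OF fg mod mod \<pi> d]) blast+
  qed
  then obtain \<sigma> where \<sigma>: "\<And>n. \<sigma> n \<in> linear_maps R (Obj F (n + 1)) (Obj F n)"
    and d\<sigma>: "\<And>n x. x \<in> carrier (Obj F (n + 1)) \<Longrightarrow> Dif F n (\<sigma> n x) = \<pi> (n + 1) x"
    by metis
  have \<sigma>': "\<sigma> (n - 1) \<in> linear_maps R (Obj F n) (Obj F (n - 1))" for n
    using \<sigma>[of "n - 1"] by simp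
  have d\<sigma>': "Dif F (n - 1) (\<sigma> (n - 1) x) = \<pi> n x" if "x \<in> carrier (Obj F n)" for n x
    using d\<sigma>[of x "n - 1"] that by simp
  have dB: "Dif F n x \<in> B (n + 1)" if "x \<in> carrier (Obj F n)" for n x
    using that by (simp add: B_def)

  define p where "p n x = x \<ominus>\<^bsub>Obj F n\<^esub> \<sigma> n (Dif F n x)" for n x
  have p: "p n \<in> linear_maps R (Obj F n) (Obj F n)" for n
    unfolding p_def[abs_def] using linear_maps_id[of R "Obj F n"]
    by (intro linear_maps_diff mod linear_maps_comp[OF d \<sigma>]) (simp add: id_def)
  have p_cycle: "p n x = x" if "x \<in> K n" for n x
    using that linear_maps_zero[OF mod mod \<sigma>] by (simp add: p_def K_iff a_minus_def)
  \<comment> \<open>Here d p = d - d \<sigma> d = d - \<pi> d, and this vanishes because \<pi> fixes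
    the boundary d x.\<close>
  have pK: "p n x \<in> K n" if "x \<in> carrier (Obj F n)" for n x
  proof -
    have dx: "Dif F n x \<in> carrier (Obj F (n + 1))" by (rule linear_maps_closed[OF d that])
    have "Dif F n (p n x) = Dif F n x \<ominus>\<^bsub>Obj F (n + 1)\<^esub> \<pi> (n + 1) (Dif F n x)"
      unfolding p_def using that dx linear_maps_closed[OF \<sigma> dx]
      by (simp add: linear_maps_minus[OF mod mod d] d\<sigma>)
    then show ?thesis
      using dx that by (simp add: K_iff linear_maps_closed[OF p] \<pi>_id dB a_minus_def M.r_neg)
  qed
  \<comment> \<open>On cocycles \<open>r\<close> chooses a representative that depends on the class
    only: it alters \<open>x\<close> by a boundary and kills boundaries, so it descends to
    cohomology as \<alpha>.\<close>
  define r where "r n x = x \<ominus>\<^bsub>Obj F n\<^esub> \<pi> n x" for n x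
  have r: "r n \<in> linear_maps R (Obj F n) (Obj F n)" for n
    unfolding r_def[abs_def] using linear_maps_id[of R "Obj F n"]
    by (intro linear_maps_diff mod \<pi>) (simp add: id_def)
  have rZ: "r n \<in> linear_maps R (Z n) (Obj F n)" for n
    unfolding Z_def by (intro linear_maps_restrict_carrier r) (auto simp: K_iff)
  have rB: "r n x = \<zero>\<^bsub>Obj F n\<^esub>" if "x \<in> B n" for n x
    using BK[OF that] by (simp add: r_def \<pi>_id that a_minus_def M.r_neg K_iff)
  have rK: "r n x \<in> K n" if "x \<in> K n" for n x
  proof -
    have "\<pi> n x \<in> K n" using that by (intro BK \<pi>B) (simp add: K_iff)
    then show ?thesis
      using that by (simp add: r_def a_minus_def M.submoduleE(3,5)[OF subK])
  qed
  define \<alpha> where "\<alpha> n A = the_elem (r n ` A)" for n A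
  have \<alpha>: "\<alpha> n \<in> linear_maps R (cohomology F n) (Obj F n)" for n
    unfolding \<alpha>_def[abs_def] H by (rule quotient_lift_linear[OF modZ subZ mod rZ rB])
  have \<alpha>q: "\<alpha> n (q n x) = r n x" if "x \<in> K n" for n x
    unfolding \<alpha>_def q_def using that by (intro quotient_lift_coset[OF modZ subZ mod rZ rB]) auto
  define g where "g n x = q n (p n x)" for n x
  have g: "g n \<in> linear_maps R (Obj F n) (cohomology F n)" for n
    unfolding g_def[abs_def]
    by (rule linear_maps_comp[OF _ q]) (unfold Z_def, intro linear_maps_corestrict_carrier p pK)
  have cosets: "\<exists>x\<in>K n. A = q n x" if "A \<in> carrier (cohomology F n)" for n A
    using that by (auto simp: H carrier_quotient q_def)

  have \<alpha>_chain: "chain_map R (cohomology_complex F) F \<alpha>"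
    unfolding chain_map_def
  proof (intro conjI allI ballI)
    fix n show "\<alpha> n \<in> linear_maps R (Obj (cohomology_complex F) n) (Obj F n)"
      using \<alpha> by (simp add: cohomology_complex_def)
    fix A assume "A \<in> carrier (Obj (cohomology_complex F) n)"
    then obtain x where "x \<in> K n" "A = q n x"
      using cosets[of A n] by (auto simp: cohomology_complex_def)
    then show "\<alpha> (n + 1) (Dif (cohomology_complex F) n A) = Dif F n (\<alpha> n A)"
      using rK[of x n] linear_maps_zero[OF modH mod \<alpha>]
      by (simp add: cohomology_complex_def \<alpha>q K_iff[of "r n x"])
  qed
  have g_chain: "chain_map R F (cohomology_complex F) g"
    unfolding chain_map_def
  proof (intro conjI allI ballI)
    fix n show "g n \<in> linear_maps R (Obj F n) (Obj (cohomology_complex F) n)"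
      using g by (simp add: cohomology_complex_def)
    fix x assume "x \<in> carrier (Obj F n)"
    then show "g (n + 1) (Dif F n x) = Dif (cohomology_complex F) n (g n x)"
      using dB[of x n] by (simp add: cohomology_complex_def g_def p_cycle BK qB)
  qed
  have g\<alpha>: "g n (\<alpha> n A) = A" if A: "A \<in> carrier (cohomology F n)" for n A
  proof -
    obtain x where x: "x \<in> K n" "A = q n x" using cosets[OF A] by blast
    have xM: "x \<in> carrier (Obj F n)" using x(1) by (simp add: K_iff)
    have \<pi>x: "\<pi> n x \<in> B n" using \<pi>B[OF xM] .
    then have \<pi>xM: "\<pi> n x \<in> carrier (Obj F n)" using BK by (auto simp: K_iff)
    have "g n (\<alpha> n A) = q n (r n x)"
      using x rK by (simp add: g_def \<alpha>q p_cycle)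
    \<comment> \<open>The class of the boundary \<open>\<pi> n x\<close> is zero; adding it restores
      the original representative \<open>x\<close>.\<close>
    also have "\<dots> = q n (r n x) \<oplus>\<^bsub>cohomology F n\<^esub> q n (\<pi> n x)"
      using rK[OF x(1)] linear_maps_closed[OF q, of "r n x" n] by (simp add: qB \<pi>x)
    also have "\<dots> = q n (r n x \<oplus>\<^bsub>Obj F n\<^esub> \<pi> n x)"
      using linear_maps_add[OF q, of "r n x" n "\<pi> n x"] rK[OF x(1)] BK[OF \<pi>x] by simp
    also have "r n x \<oplus>\<^bsub>Obj F n\<^esub> \<pi> n x = x"
      using xM \<pi>xM by (simp add: r_def a_minus_def M.a_assoc M.l_neg)
    finally show ?thesis using x(2) by simp
  qed
  \<comment> \<open>On classes \<open>g \<circ> \<alpha>\<close> is the identity on the nose, so the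
    zero homotopy serves.\<close>
  have "chain_homotopic R (cohomology_complex F) (cohomology_complex F) (\<lambda>n. g n \<circ> \<alpha> n) (\<lambda>n. id)"
    unfolding chain_homotopic_def
  proof (intro exI conjI allI ballI)
    fix n
    show "(\<lambda>x. \<zero>\<^bsub>cohomology F (n - 1)\<^esub>)
        \<in> linear_maps R (Obj (cohomology_complex F) n) (Obj (cohomology_complex F) (n - 1))"
      by (simp add: cohomology_complex_def linear_maps_const_zero[OF modH])
    fix A assume "A \<in> carrier (Obj (cohomology_complex F) n)"
    then show "(g n \<circ> \<alpha> n) A \<ominus>\<^bsub>Obj (cohomology_complex F) n\<^esub> id A
      = Dif (cohomology_complex F) (n - 1) \<zero>\<^bsub>cohomology F (n - 1)\<^esub>
        \<oplus>\<^bsub>Obj (cohomology_complex F) n\<^esub> \<zero>\<^bsub>cohomology F (n + 1 - 1)\<^esub>"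
      by (simp add: cohomology_complex_def g\<alpha> a_minus_def H.r_neg)
  qed
  moreover have "chain_homotopic R F F (\<lambda>n. \<alpha> n \<circ> g n) (\<lambda>n. id)"
    unfolding chain_homotopic_def
  proof (intro exI conjI allI ballI)
    fix n
    \<comment> \<open>The choice -\<sigma> p is read off from \<alpha> g x - x = p x - \<pi> p x - x
      = -\<pi> p x - \<sigma> d x. The first term is d \<Psi> x because d \<sigma> = \<pi>; the
      second is \<Psi> d x because p fixes the cocycle d x.\<close>
    show "(\<lambda>x. \<ominus>\<^bsub>Obj F (n - 1)\<^esub> \<sigma> (n - 1) (p n x)) \<in> linear_maps R (Obj F n) (Obj F (n - 1))"
      by (intro linear_maps_uminus mod linear_maps_comp[OF p \<sigma>'])
    fix x assume x: "x \<in> carrier (Obj F n)"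
    define s where "s = \<sigma> n (Dif F n x)"
    define w where "w = \<pi> n (p n x)"
    have s: "s \<in> carrier (Obj F n)" and w: "w \<in> carrier (Obj F n)"
      by (auto simp: s_def w_def intro!: linear_maps_closed[OF \<sigma>] linear_maps_closed[OF d]
          linear_maps_closed[OF \<pi>] linear_maps_closed[OF p] x)
    have "(\<alpha> n \<circ> g n) x \<ominus>\<^bsub>Obj F n\<^esub> id x = ((x \<ominus>\<^bsub>Obj F n\<^esub> s) \<ominus>\<^bsub>Obj F n\<^esub> w) \<ominus>\<^bsub>Obj F n\<^esub> x"
      using pK[OF x] by (simp add: g_def \<alpha>q) (simp add: r_def w_def s_def p_def)
    also have "\<dots> = \<ominus>\<^bsub>Obj F n\<^esub> w \<oplus>\<^bsub>Obj F n\<^esub> \<ominus>\<^bsub>Obj F n\<^esub> s"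
    proof -
      have "((x \<ominus>\<^bsub>Obj F n\<^esub> s) \<ominus>\<^bsub>Obj F n\<^esub> w) \<ominus>\<^bsub>Obj F n\<^esub> x
          = (\<ominus>\<^bsub>Obj F n\<^esub> w \<oplus>\<^bsub>Obj F n\<^esub> \<ominus>\<^bsub>Obj F n\<^esub> s) \<oplus>\<^bsub>Obj F n\<^esub> (x \<oplus>\<^bsub>Obj F n\<^esub> \<ominus>\<^bsub>Obj F n\<^esub> x)"
        using x s w by (simp add: a_minus_def M.a_ac)
      then show ?thesis using x s w by (simp add: M.r_neg)
    qed
    also have "\<ominus>\<^bsub>Obj F n\<^esub> w = Dif F (n - 1) (\<ominus>\<^bsub>Obj F (n - 1)\<^esub> \<sigma> (n - 1) (p n x))"
      using linear_maps_closed[OF p x] linear_maps_closed[OF \<sigma>']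
      by (simp add: linear_maps_a_inv[OF mod mod d'] d\<sigma>' w_def)
    also have "\<ominus>\<^bsub>Obj F n\<^esub> s = \<ominus>\<^bsub>Obj F (n + 1 - 1)\<^esub> \<sigma> (n + 1 - 1) (p (n + 1) (Dif F n x))"
      by (simp add: s_def p_cycle BK dB x)
    finally show "(\<alpha> n \<circ> g n) x \<ominus>\<^bsub>Obj F n\<^esub> id x
      = Dif F (n - 1) (\<ominus>\<^bsub>Obj F (n - 1)\<^esub> \<sigma> (n - 1) (p n x))
        \<oplus>\<^bsub>Obj F n\<^esub> \<ominus>\<^bsub>Obj F (n + 1 - 1)\<^esub> \<sigma> (n + 1 - 1) (p (n + 1) (Dif F n x))" .
  qed
  ultimately show ?thesis
    unfolding homotopy_equivalence_def using \<alpha>_chain g_chain by blast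
qed

section \<open>Cohomology as a categorified eigenvalue\<close>

theorem corollary3p4:
  fixes R :: "('r, 'e) ring_scheme" and F :: "('r, 'm) chain_cplx"
  assumes "cring R" and "\<one>\<^bsub>R\<^esub> \<noteq> \<zero>\<^bsub>R\<^esub>"
    and "fg_free_complex R F"
    and "\<And>n. \<exists>G. submodule G R (Obj F n) \<and>
           internal_direct_sum (Obj F n) G (Dif F (n - 1) ` carrier (Obj F (n - 1)))"
    and "\<And>n. fg_free R (cohomology F n)"
  shows "categorified_eigenvalue TYPE('t) R F (cohomology_complex F) (ring_complex R)"
proof -
  have "module R (cohomology F n)" for n
    using assms(5)[of n] by (simp add: fg_free_def)
  then have H: "chain_complex R (cohomology_complex F)"
    by (rule chain_complex_cohomology_complex)
  then have "fg_free_complex R (cohomology_complex F)"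
    using assms(5) by (simp add: fg_free_complex_def cohomology_complex_def)
  moreover have V: "fg_free_complex R (ring_complex R)"
    using assms(1) by (rule fg_free_complex_ring_complex)
  moreover have "nonzero_complex (ring_complex R)"
    unfolding nonzero_complex_def
  proof
    \<comment> \<open>Degree 0 witnesses that the complex is nonzero: there 1 is an element
      different from 0.\<close>
    interpret R: cring R by fact
    show "carrier (Obj (ring_complex R) 0) \<noteq> {\<zero>\<^bsub>Obj (ring_complex R) 0\<^esub>}"
      using assms(2) R.one_closed by (auto simp: ring_complex_def ring_module_def)
  qed
  moreover obtain \<alpha> where \<alpha>: "homotopy_equivalence R (cohomology_complex F) F \<alpha>"
    using cohomology_homotopy_equivalence[OF assms(3,4)] by blast
  moreover have "homotopy_equivalence R (tensor_complex R (cohomology_complex F) (ring_complex R))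
      (tensor_complex R F (ring_complex R)) (tensor_chain_map R F (ring_complex R) \<alpha> (\<lambda>n. id))"
    using assms(3) V \<alpha> by (intro homotopy_equivalence_tensor H) (simp_all add: fg_free_complex_def)
  moreover have "chain_map R (cohomology_complex F) F \<alpha>"
    using \<alpha> by (simp add: homotopy_equivalence_def)
  ultimately show ?thesis
    unfolding categorified_eigenvalue_def using assms(3) scalar_object_chain_complex[OF H] by blast
qed

end
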